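(* Let $\alpha_1\in\mathbb{R}\setminus\mathbb{Q}$ and let $\gamma_1,\gamma_2\in\mathbb{R}$. Then for almost all $\alpha_2\in\mathbb{R}$, \[\liminf_{n\to\infty} n(\log n)^2\|n\alpha_1-\gamma_1\|\cdot\|n\alpha_2-\gamma_2\|=0.\]
   Context: $\|x\|$ denotes the distance from $x$ to the nearest integer. "Almost all" refers to Lebesgue measure. *)

theory Defs
  imports "HOL-Analysis.Analysis"
begin

definition dist_nearest_int :: "real \<Rightarrow> real" where
  "dist_nearest_int x = \<bar>x - of_int (round x)\<bar>"

end

theory Submission
  imports Defs "HOL-Number_Theory.Cong"
begin

text \<open>
  Let \<open>p / Q\<close> be a convergent-type approximation of \<open>\<alpha>1\<close> and \<open>t\<close> of the order of \<open>log Q\<close>. For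
  \<open>i, j < t\<close> consider the \<open>n\<close> of size about \<open>N = Q\<^sup>2 * 2 ^ i\<close> with \<open>n * \<alpha>1 - \<gamma>1\<close> within \<open>\<delta> = 4 ^ (- j - 2)\<close> of
  an integer; by equidistribution modulo \<open>Q\<close> there are about \<open>N * \<delta>\<close> of them. The sets of \<open>\<alpha>2\<close>
  with \<open>n * \<alpha>2 - \<gamma>2\<close> within \<open>\<epsilon> / (N * \<delta> * t\<^sup>2)\<close> of an integer therefore have total measure of order \<open>\<epsilon>\<close>,
  whatever the size of \<open>Q\<close>, and each hit makes the product in the theorem \<open>O(\<epsilon>)\<close>.

  The overlap of the sets for \<open>n\<close> and \<open>m\<close> is at most a constant times the product of the measures
  plus a constant times \<open>gcd n m\<close> and the shorter interval length, so the counting function \<open>G\<close> of the hits is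
  bounded in \<open>L\<^sup>2\<close> as soon as \<open>gcd n m\<close> is well distributed on the Bohr sets. For small gcd \<open>d\<close> one counts
  the multiples of \<open>d\<close>, using approximations to \<open>d * \<alpha>1\<close>; for large gcd one fixes the cofactors and counts \<open>d\<close>.

  Finally \<open>G\<close> has integral at least \<open>\<epsilon> * (v - u)\<close> over every interval \<open>(u, v)\<close> once \<open>Q\<close> is large. A family
  bounded in \<open>L\<^sup>2\<close> with this property cannot vanish on a fixed set of positive measure, hence almost
  every \<open>\<alpha>2\<close> is hit in infinitely many blocks.
\<close>

section \<open>Counting in progressions modulo one\<close>

text \<open>The existential form lets any integer serve as witness, so that perturbation and integer
  shifts are immediate and measurability reduces to a countable union of closed sets.\<close>

definition near :: "real \<Rightarrow> real \<Rightarrow> bool" where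
  "near z x \<longleftrightarrow> (\<exists>k::int. \<bar>x - of_int k\<bar> \<le> z)"

lemma near_perturb:
  assumes "near z x" "\<bar>y - x\<bar> \<le> e" "z + e \<le> z'"
  shows "near z' y"
proof -
  from assms(1) obtain k :: int where "\<bar>x - of_int k\<bar> \<le> z" by (auto simp: near_def)
  then have "\<bar>y - of_int k\<bar> \<le> z'" using assms(2,3) by linarith
  then show ?thesis by (auto simp: near_def)
qed

lemma near_iff_dist: "near z x \<longleftrightarrow> dist_nearest_int x \<le> z"
proof
  assume "near z x"
  then obtain k :: int where k: "\<bar>x - of_int k\<bar> \<le> z" by (auto simp: near_def)
  have "dist_nearest_int x \<le> \<bar>x - of_int k\<bar>"
    using round_diff_minimal[of x k] by (simp add: dist_nearest_int_def)
  with k show "dist_nearest_int x \<le> z" by linarith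
qed (auto simp: near_def dist_nearest_int_def)

lemma finite_int_interval_filter [simp]: "finite {j::int. a \<le> j \<and> j < b \<and> P j}"
  by (rule finite_subset[of _ "{a..<b}"]) auto

lemma card_int_interval_le:
  fixes x y :: real
  assumes "x \<le> y + 1"
  shows "finite {v::int. x \<le> of_int v \<and> of_int v \<le> y}"
    and "real (card {v::int. x \<le> of_int v \<and> of_int v \<le> y}) \<le> y - x + 1"
proof -
  have eq: "{v::int. x \<le> of_int v \<and> of_int v \<le> y} = {\<lceil>x\<rceil>..\<lfloor>y\<rfloor>}"
    by (auto simp: ceiling_le_iff le_floor_iff)
  show "finite {v::int. x \<le> of_int v \<and> of_int v \<le> y}" unfolding eq by simp
  have "real_of_int \<lfloor>y\<rfloor> - real_of_int \<lceil>x\<rceil> + 1 \<le> y - x + 1" by linarith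
  then show "real (card {v::int. x \<le> of_int v \<and> of_int v \<le> y}) \<le> y - x + 1"
    unfolding eq using assms by (cases "\<lfloor>y\<rfloor> + 1 \<ge> \<lceil>x\<rceil>") auto
qed

lemma card_int_interval_ge:
  fixes x y :: real
  shows "y - x - 1 \<le> real (card {v::int. x \<le> of_int v \<and> of_int v \<le> y})"
proof -
  have eq: "{v::int. x \<le> of_int v \<and> of_int v \<le> y} = {\<lceil>x\<rceil>..\<lfloor>y\<rfloor>}"
    by (auto simp: ceiling_le_iff le_floor_iff)
  have "y - x - 1 \<le> real_of_int (\<lfloor>y\<rfloor> - \<lceil>x\<rceil> + 1)" by linarith
  also have "\<dots> \<le> real (nat (\<lfloor>y\<rfloor> + 1 - \<lceil>x\<rceil>))" by linarith
  finally show ?thesis unfolding eq by simp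
qed

lemma eq_of_dvd_diff_block:
  fixes i j j0 :: int
  assumes "i \<in> {j0..<j0 + int n}" "j \<in> {j0..<j0 + int n}" "int n dvd i - j"
  shows "i = j"
proof (rule ccontr)
  assume "i \<noteq> j"
  then have "int n \<le> \<bar>i - j\<bar>" using dvd_imp_le_int[of "i - j" "int n"] assms(3) by simp
  then show False using assms(1,2) by auto
qed

text \<open>The integer \<open>j * a - k j * n\<close> encodes the offset from the nearest integer
  \<open>k j\<close>. It lies in a window of length \<open>2 * z * n\<close> about
  \<open>- c * n\<close> and determines \<open>j\<close> modulo \<open>n\<close>, because
  \<open>a\<close> is invertible there; so it suffices to count the integers of the window.\<close>

lemma card_near_block_le:
  fixes a j0 :: int and n :: nat and z c :: real
  assumes n: "n > 0" and cop: "coprime a (int n)" and z: "z \<ge> 0"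
  shows "real (card {j \<in> {j0..<j0 + int n}. near z (of_int j * of_int a / real n + c)}) \<le> 2 * z * real n + 1"
proof -
  let ?S = "{j \<in> {j0..<j0 + int n}. near z (of_int j * of_int a / real n + c)}"
  let ?V = "{v::int. - c * n - z * n \<le> of_int v \<and> of_int v \<le> - c * n + z * n}"
  define k :: "int \<Rightarrow> int" where "k j = round (of_int j * of_int a / real n + c)" for j
  have k: "\<bar>of_int j * of_int a / real n + c - of_int (k j)\<bar> \<le> z" if "j \<in> ?S" for j
    using that by (auto simp: near_iff_dist dist_nearest_int_def k_def)
  define f where "f j = j * a - k j * int n" for j
  have zn: "0 \<le> z * n" using z by simp
  have sub: "f ` ?S \<subseteq> ?V"
  proof
    fix v assume "v \<in> f ` ?S"
    then obtain j where j: "j \<in> ?S" and v: "v = f j" by auto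
    have "\<bar>of_int j * of_int a / real n + c - of_int (k j)\<bar> * n \<le> z * n"
      using k[OF j] by (intro mult_right_mono) auto
    moreover have "(of_int j * of_int a / real n + c - of_int (k j)) * n = of_int v + c * n"
      using n by (simp add: v f_def field_simps)
    ultimately have "\<bar>of_int v + c * n\<bar> \<le> z * n"
      by (metis abs_mult abs_of_nat)
    then show "v \<in> ?V" by auto
  qed
  have inj: "inj_on f ?S"
  proof (rule inj_onI)
    fix i j assume ij: "i \<in> ?S" "j \<in> ?S" and eq: "f i = f j"
    have "(i - j) * a = (k i - k j) * int n" using eq by (simp add: f_def algebra_simps)
    then have "int n dvd (i - j) * a" by simp
    then have "int n dvd i - j" using cop by (simp add: coprime_commute coprime_dvd_mult_left_iff)
    then show "i = j" using ij eq_of_dvd_diff_block[of i j0 n j] by auto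
  qed
  have zz: "- c * n - z * n \<le> - c * n + z * n + 1" using zn by linarith
  have "card ?S = card (f ` ?S)" by (rule card_image[OF inj, symmetric])
  also have "\<dots> \<le> card ?V" by (intro card_mono sub card_int_interval_le(1)[OF zz])
  also have "real (card ?V) \<le> (- c * n + z * n) - (- c * n - z * n) + 1"
    by (rule card_int_interval_le(2)[OF zz])
  finally show ?thesis by simp
qed

text \<open>Converse construction: an inverse \<open>b\<close> of \<open>a\<close> modulo
  \<open>n\<close> turns each integer of the window into an index of the block. The bound
  \<open>z < 1/2\<close> keeps the window shorter than \<open>n\<close>, so that different integers
  are different residues.\<close>

lemma card_near_block_ge:
  fixes a j0 :: int and n :: nat and z c :: real
  assumes n: "n > 0" and cop: "coprime a (int n)" and z: "z < 1/2"
  shows "2 * z * real n - 1 \<le> real (card {j \<in> {j0..<j0 + int n}. near z (of_int j * of_int a / real n + c)})"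
proof -
  let ?S = "{j \<in> {j0..<j0 + int n}. near z (of_int j * of_int a / real n + c)}"
  let ?V = "{v::int. - c * n - z * n \<le> of_int v \<and> of_int v \<le> - c * n + z * n}"
  obtain b where b: "[a * b = 1] (mod (int n))"
    using cop cong_solve_coprime_int[of a "int n"] by auto
  \<comment> \<open>This is the representative of \<open>v * b\<close> modulo \<open>n\<close> that
    falls into the block starting at \<open>j0\<close>.\<close>
  define g where "g v = j0 + ((v * b - j0) mod int n)" for v
  have gcong: "int n dvd g v * a - v" for v
  proof -
    have "[g v = v * b] (mod (int n))"
      by (simp add: g_def cong_def mod_simps)
    then have "[g v * a = v * b * a] (mod (int n))" by (rule cong_scalar_right)
    also have "v * b * a = v * (a * b)" by simp
    also have "[v * (a * b) = v * 1] (mod (int n))" by (rule cong_scalar_left[OF b])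
    finally show ?thesis by (simp add: cong_iff_dvd_diff)
  qed
  have sub: "g ` ?V \<subseteq> ?S"
  proof
    fix j assume "j \<in> g ` ?V"
    then obtain v where v: "v \<in> ?V" and j: "j = g v" by auto
    obtain k where k: "g v * a - v = int n * k" using gcong by (metis dvdE)
    have "\<bar>of_int j * of_int a / real n + c - of_int k\<bar> = \<bar>of_int v + c * n\<bar> / n"
    proof -
      have "of_int j * of_int a - of_int k * real n = of_int v"
        using arg_cong[OF k, of real_of_int] by (simp add: j algebra_simps)
      then have "(of_int v + c * n) / n = (of_int j * of_int a - of_int k * real n + c * n) / n" by simp
      also have "\<dots> = of_int j * of_int a / real n + c - of_int k"
        using n by (simp add: add_divide_distrib diff_divide_distrib)
      finally show ?thesis by (simp add: abs_div_pos n)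
    qed
    also have "\<dots> \<le> z" using v n by (auto simp: field_simps abs_le_iff)
    finally have "near z (of_int j * of_int a / real n + c)" by (auto simp: near_def)
    then show "j \<in> ?S" using n by (auto simp: j g_def)
  qed
  have inj: "inj_on g ?V"
  proof (rule inj_onI)
    fix u v assume uv: "u \<in> ?V" "v \<in> ?V" and eq: "g u = g v"
    have "int n dvd u - v" using dvd_diff[OF gcong[of v] gcong[of u]] eq by simp
    moreover have "\<bar>u - v\<bar> < int n"
    proof -
      have "real_of_int \<bar>u - v\<bar> \<le> 2 * (z * n)" using uv by auto
      also have "\<dots> < real n" using z n by (simp add: field_simps)
      finally show ?thesis by linarith
    qed
    ultimately show "u = v" using zdvd_imp_le[of "int n" "\<bar>u - v\<bar>"] by fastforce
  qed
  have "2 * z * real n - 1 = (- c * n + z * n) - (- c * n - z * n) - 1" by simp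
  also have "\<dots> \<le> real (card ?V)" by (rule card_int_interval_ge)
  also have "card ?V = card (g ` ?V)" by (rule card_image[OF inj, symmetric])
  also have "real \<dots> \<le> card ?S" using card_mono[OF _ sub] by simp
  finally show ?thesis .
qed

lemma block_cover:
  fixes x :: int and Y r :: nat
  assumes "r > 0"
  shows "{x..<x + int Y} \<subseteq> (\<Union>k<Y div r + 1. {x + int (k * r)..<x + int (k * r) + int r})"
proof
  fix j assume j: "j \<in> {x..<x + int Y}"
  define k where "k = nat (j - x) div r"
  have "k \<le> Y div r" unfolding k_def using j by (intro div_le_mono) auto
  moreover have "int (k * r) \<le> j - x" "j - x < int (k * r) + int r"
  proof -
    have "nat (j - x) = k * r + nat (j - x) mod r" by (simp add: k_def)
    moreover have "nat (j - x) mod r < r" using assms by simp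
    moreover have "int (nat (j - x)) = j - x" using j by simp
    ultimately have "int (k * r) \<le> j - x \<and> j - x < int (k * r) + int r" by linarith
    then show "int (k * r) \<le> j - x" "j - x < int (k * r) + int r" by auto
  qed
  ultimately show "j \<in> (\<Union>k<Y div r + 1. {x + int (k * r)..<x + int (k * r) + int r})"
    by (intro UN_I[of k]) auto
qed

lemma card_filter_blocks_le:
  fixes x :: int and Y r :: nat
  assumes r: "r > 0" and A: "A \<ge> 0"
    and block: "\<And>j0. real (card {j \<in> {j0..<j0 + int r}. P j}) \<le> A"
  shows "real (card {j \<in> {x..<x + int Y}. P j}) \<le> (real Y / real r + 1) * A"
proof -
  let ?B = "\<lambda>k. {j \<in> {x + int (k * r)..<x + int (k * r) + int r}. P j}"
  have sub: "{j \<in> {x..<x + int Y}. P j} \<subseteq> (\<Union>k<Y div r + 1. ?B k)"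
  proof
    fix j assume j: "j \<in> {j \<in> {x..<x + int Y}. P j}"
    then obtain k where "k < Y div r + 1" "j \<in> {x + int (k * r)..<x + int (k * r) + int r}"
      using subsetD[OF block_cover[OF r, of x Y], of j] by (simp, blast)
    then show "j \<in> (\<Union>k<Y div r + 1. ?B k)" using j by blast
  qed
  have "card {j \<in> {x..<x + int Y}. P j} \<le> card (\<Union>k<Y div r + 1. ?B k)"
    by (rule card_mono[OF _ sub]) auto
  also have "\<dots> \<le> (\<Sum>k<Y div r + 1. card (?B k))" by (rule card_UN_le) simp
  finally have "real (card {j \<in> {x..<x + int Y}. P j}) \<le> (\<Sum>k<Y div r + 1. real (card (?B k)))"
    using of_nat_mono by fastforce
  also have "\<dots> \<le> (\<Sum>k<Y div r + 1. A)" by (intro sum_mono block)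
  also have "\<dots> = (real (Y div r) + 1) * A" by simp
  also have "\<dots> \<le> (real Y / real r + 1) * A"
    using A by (intro mult_right_mono add_right_mono of_nat_div_le_of_nat)
  finally show ?thesis .
qed

text \<open>On a short block the slope \<open>\<beta>\<close> may be replaced by a nearby
  \<open>b\<close>: the discrepancy at \<open>j0\<close> goes into the constant, which leaves a
  drift of at most \<open>r * |\<beta> - b|\<close>.\<close>

lemma near_block_perturb:
  fixes j j0 :: int and \<beta> z c d :: real
  assumes j: "j \<in> {j0..<j0 + int r}" and dr: "real r * \<bar>\<beta> - b\<bar> \<le> d"
    and nr: "near z (of_int j * \<beta> + c)" and "z + d \<le> z'"
  shows "near z' (of_int j * b + (of_int j0 * \<beta> - of_int j0 * b + c))"
proof (rule near_perturb[OF nr])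
  have "\<bar>of_int j * b + (of_int j0 * \<beta> - of_int j0 * b + c) - (of_int j * \<beta> + c)\<bar>
     = \<bar>of_int (j0 - j)\<bar> * \<bar>\<beta> - b\<bar>" by (simp add: algebra_simps flip: abs_mult)
  also have "\<dots> \<le> real r * \<bar>\<beta> - b\<bar>" using j by (intro mult_right_mono) auto
  finally show "\<bar>of_int j * b + (of_int j0 * \<beta> - of_int j0 * b + c) - (of_int j * \<beta> + c)\<bar> \<le> d"
    using dr by linarith
qed (use assms in auto)

lemma near_block_perturb':
  fixes j j0 :: int and \<beta> z c d :: real
  assumes j: "j \<in> {j0..<j0 + int r}" and dr: "real r * \<bar>\<beta> - b\<bar> \<le> d"
    and nr: "near z (of_int j * b + (of_int j0 * \<beta> - of_int j0 * b + c))" and "z + d \<le> z'"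
  shows "near z' (of_int j * \<beta> + c)"
  using near_block_perturb[of j j0 r b \<beta> d z "of_int j0 * \<beta> - of_int j0 * b + c" z'] assms
  by (simp add: abs_minus_commute)

lemma card_near_progression_le:
  fixes a x :: int and r Y :: nat
  assumes r: "r > 0" and cop: "coprime a (int r)" and e: "e \<ge> 0"
    and \<beta>: "real r * \<bar>\<beta> - of_int a / real r\<bar> \<le> e"
    and \<delta>: "\<delta> \<ge> 0"
  shows "real (card {j \<in> {x..<x + int Y}. near \<delta> (of_int j * \<beta> + c)})
    \<le> (real Y / real r + 1) * (2 * (\<delta> + e) * real r + 1)"
proof (rule card_filter_blocks_le[OF r])
  show "0 \<le> 2 * (\<delta> + e) * real r + 1" using \<delta> e by simp
next
  fix j0 :: int
  let ?c = "of_int j0 * \<beta> - of_int j0 * (of_int a / real r) + c"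
  have sub: "{j \<in> {j0..<j0 + int r}. near \<delta> (of_int j * \<beta> + c)}
      \<subseteq> {j \<in> {j0..<j0 + int r}. near (\<delta> + e) (of_int j * of_int a / real r + ?c)}"
    using near_block_perturb[OF _ \<beta>, of _ j0 \<delta> c "\<delta> + e"] by auto
  have "card {j \<in> {j0..<j0 + int r}. near \<delta> (of_int j * \<beta> + c)}
      \<le> card {j \<in> {j0..<j0 + int r}. near (\<delta> + e) (of_int j * of_int a / real r + ?c)}"
    by (rule card_mono[OF _ sub]) simp
  then show "real (card {j \<in> {j0..<j0 + int r}. near \<delta> (of_int j * \<beta> + c)}) \<le> 2 * (\<delta> + e) * real r + 1"
    using card_near_block_le[OF r cop, of "\<delta> + e" j0 ?c] \<delta> e by simp
qed

text \<open>The size conditions absorb the rounding terms: \<open>Y / r + 1 <= 2 * Y / r\<close> and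
  \<open>4 * \<delta> * r + 1 <= 5 * \<delta> * r\<close>.\<close>

lemma card_near_progression_le':
  fixes a x :: int and r Y :: nat
  assumes r: "r > 0" and cop: "coprime a (int r)"
    and \<beta>: "real r * \<bar>\<beta> - of_int a / real r\<bar> \<le> \<delta>"
    and \<delta>: "1 \<le> \<delta> * r" and rY: "r \<le> Y"
  shows "real (card {j \<in> {x..<x + int Y}. near \<delta> (of_int j * \<beta> + c)}) \<le> 10 * \<delta> * real Y"
proof -
  have \<delta>0: "\<delta> \<ge> 0" using \<beta> by (meson abs_ge_zero mult_nonneg_nonneg of_nat_0_le_iff order_trans)
  have "real (card {j \<in> {x..<x + int Y}. near \<delta> (of_int j * \<beta> + c)})
     \<le> (real Y / real r + 1) * (2 * (\<delta> + \<delta>) * real r + 1)"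
    by (rule card_near_progression_le[OF r cop \<delta>0 \<beta> \<delta>0])
  also have "\<dots> \<le> (2 * real Y / real r) * (5 * (\<delta> * real r))"
    using r rY \<delta> \<delta>0 by (intro mult_mono) (auto simp: field_simps)
  also have "\<dots> = 10 * \<delta> * real Y" using r by simp
  finally show ?thesis .
qed

text \<open>Whole blocks of length \<open>Q\<close> are added one at a time. In each, the radius is
  shrunk by \<open>1 / Q\<close> to survive the passage to \<open>p / Q\<close>, and
  \<open>2 * (\<delta> - 1 / Q) * Q - 1 = 2 * \<delta> * Q - 3\<close> is still at least
  \<open>\<delta> * Q\<close>.\<close>

lemma card_near_progression_ge:
  fixes p x :: int and Q K :: nat
  assumes Q: "Q > 0" and cop: "coprime p (int Q)"
    and \<alpha>: "real Q * \<bar>\<alpha> - of_int p / real Q\<bar> \<le> 1 / real Q"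
    and \<delta>: "3 \<le> \<delta> * real Q" "\<delta> \<le> 1/2"
  shows "\<delta> * real (Q * K) \<le> real (card {j \<in> {x..<x + int (Q * K)}. near \<delta> (of_int j * \<alpha> + c)})"
proof (induction K)
  case (Suc K)
  let ?P = "\<lambda>j. near \<delta> (of_int j * \<alpha> + c)"
  define j0 where "j0 = x + int (Q * K)"
  have un: "{j \<in> {x..<x + int (Q * Suc K)}. ?P j} = {j \<in> {x..<x + int (Q * K)}. ?P j} \<union> {j \<in> {j0..<j0 + int Q}. ?P j}"
  proof -
    have "0 \<le> int (Q * K)" by simp
    moreover have "int (Q * Suc K) = int (Q * K) + int Q" by simp
    ultimately show ?thesis by (intro set_eqI) (simp only: j0_def Un_iff mem_Collect_eq atLeastLessThan_iff, linarith)
  qed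
  have "card {j \<in> {x..<x + int (Q * Suc K)}. ?P j} = card {j \<in> {x..<x + int (Q * K)}. ?P j} + card {j \<in> {j0..<j0 + int Q}. ?P j}"
    unfolding un by (rule card_Un_disjoint) (auto simp: j0_def)
  moreover have "\<delta> * Q \<le> card {j \<in> {j0..<j0 + int Q}. ?P j}"
  proof -
    let ?c = "of_int j0 * \<alpha> - of_int j0 * (of_int p / real Q) + c"
    have "\<delta> * Q \<le> 2 * (\<delta> - 1 / Q) * real Q - 1" using \<delta> Q by (simp add: field_simps)
    also have "\<dots> \<le> card {j \<in> {j0..<j0 + int Q}. near (\<delta> - 1 / Q) (of_int j * of_int p / real Q + ?c)}"
    proof (rule card_near_block_ge[OF Q cop])
      show "\<delta> - 1 / real Q < 1 / 2" using \<delta>(2) Q by (smt (verit) divide_pos_pos of_nat_0_less_iff)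
    qed
    also have "\<dots> \<le> card {j \<in> {j0..<j0 + int Q}. ?P j}"
      using near_block_perturb'[OF _ \<alpha>, of _ j0 "\<delta> - 1 / Q" c \<delta>] by (intro of_nat_mono card_mono) auto
    finally show ?thesis .
  qed
  ultimately show ?case using Suc by (simp add: algebra_simps)
qed simp

section \<open>Overlaps\<close>

lemma near_add_int [simp]: "near z (x + of_int k) \<longleftrightarrow> near z x"
proof
  assume "near z (x + of_int k)"
  then obtain l :: int where "\<bar>x + of_int k - of_int l\<bar> \<le> z" by (auto simp: near_def)
  then have "\<bar>x - of_int (l - k)\<bar> \<le> z" by (simp add: algebra_simps)
  then show "near z x" unfolding near_def by blast
next
  assume "near z x"
  then obtain l :: int where "\<bar>x - of_int l\<bar> \<le> z" by (auto simp: near_def)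
  then have "\<bar>x + of_int k - of_int (l + k)\<bar> \<le> z" by (simp add: algebra_simps)
  then show "near z (x + of_int k)" unfolding near_def by blast
qed

lemma borel_near [measurable]: "{t::real. near z (u * t + c)} \<in> sets borel"
proof -
  have "{t::real. near z (u * t + c)} = (\<Union>k::int. {t. \<bar>u * t + c - of_int k\<bar> \<le> z})"
    by (auto simp: near_def)
  moreover have "closed {t. \<bar>u * t + c - of_int k\<bar> \<le> z}" for k :: int
    by (intro closed_Collect_le continuous_intros)
  ultimately show ?thesis by (auto intro!: sets.countable_UN borel_closed)
qed

lemma fmeasurable_lborel_interval [simp]:
  fixes u v :: real
  shows "{u..v} \<in> fmeasurable lborel" "{u..<v} \<in> fmeasurable lborel"
proof -
  show *: "{u..v} \<in> fmeasurable lborel" by (intro fmeasurableI) (auto simp: emeasure_lborel_Icc_eq)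
  show "{u..<v} \<in> fmeasurable lborel" by (rule fmeasurableI2[OF *]) auto
qed

lemma measure_union_spaced_intervals:
  fixes h w c :: real and S :: "int set"
  assumes "finite S" "0 \<le> w" "w \<le> h" "0 < h"
  shows "measure lborel (\<Union>a\<in>S. {h * of_int a + c..<h * of_int a + c + w}) = real (card S) * w"
proof -
  let ?I = "\<lambda>a::int. {h * of_int a + c..<h * of_int a + c + w}"
  have "?I a \<inter> ?I b = {}" if "a < b" for a b
  proof -
    have "h * (of_int a + 1) \<le> h * of_int b" using that assms by (intro mult_left_mono) auto
    then have "h * of_int a + w \<le> h * of_int b" using assms(3) by (simp add: distrib_left)
    then show ?thesis by auto
  qed
  then have "disjoint_family_on ?I S"
    unfolding disjoint_family_on_def by (metis inf_commute linorder_less_linear)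
  then have "measure lborel (\<Union>a\<in>S. ?I a) = (\<Sum>a\<in>S. measure lborel (?I a))"
    using assms by (intro measure_finite_Union) auto
  then show ?thesis using assms by simp
qed

text \<open>Only integers whose whole interval of radius \<open>\<psi> / n\<close> fits into the
  window are used. There are at least \<open>n * (v - u) - 2\<close>, hence at least
  \<open>n * (v - u) / 2\<close> of them, and each contributes
  \<open>2 * \<psi> / n\<close>.\<close>

lemma measure_near_ge:
  fixes n :: nat and u v \<psi> c :: real
  assumes n: "4 \<le> real n * (v - u)" and \<psi>: "0 \<le> \<psi>" "\<psi> < 1/2"
  shows "\<psi> * (v - u) \<le> measure lborel ({u..<v} \<inter> {t. near \<psi> (real n * t + c)})"
proof -
  have n0: "n > 0" using n by (cases n) auto
  have uv: "u < v" using n n0 by (smt (verit) mult_nonneg_nonpos of_nat_0_le_iff)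
  define S where "S = {a::int. n * u + c + \<psi> \<le> of_int a \<and> of_int a \<le> n * v + c - \<psi>}"
  have fin: "finite S" unfolding S_def
    by (rule card_int_interval_le) (use n \<psi> in \<open>simp add: algebra_simps\<close>)
  have cS: "n * (v - u) / 2 \<le> card S"
  proof -
    have "n * (v - u) / 2 \<le> (n * v + c - \<psi>) - (n * u + c + \<psi>) - 1"
    proof -
      define A B where "A = n * v" and "B = n * u"
      have "4 \<le> A - B" using n by (simp add: A_def B_def right_diff_distrib)
      moreover have "n * (v - u) = A - B" by (simp add: A_def B_def right_diff_distrib)
      ultimately show ?thesis unfolding A_def[symmetric] B_def[symmetric] using \<psi> by simp
    qed
    also have "\<dots> \<le> card S" unfolding S_def by (rule card_int_interval_ge)
    finally show ?thesis .
  qed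
  let ?U = "(\<Union>a\<in>S. {(1/n) * of_int a + (- c - \<psi>) / n..<(1/n) * of_int a + (- c - \<psi>) / n + 2 * \<psi> / n})"
  have sub: "?U \<subseteq> {u..<v} \<inter> {t. near \<psi> (real n * t + c)}"
  proof
    fix t assume "t \<in> ?U"
    then obtain a where a: "a \<in> S" and "(1/n) * of_int a + (- c - \<psi>) / n \<le> t"
      "t < (1/n) * of_int a + (- c - \<psi>) / n + 2 * \<psi> / n" by auto
    then have t: "of_int a - c - \<psi> \<le> n * t" "n * t < of_int a - c + \<psi>"
      using n0 by (simp_all add: field_simps)
    have "n * u \<le> n * t" "n * t < n * v" using a t by (auto simp: S_def)
    then have "u \<le> t" "t < v" using n0 by simp_all
    moreover have "near \<psi> (n * t + c)" unfolding near_def using t by (intro exI[of _ a]) auto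
    ultimately show "t \<in> {u..<v} \<inter> {t. near \<psi> (real n * t + c)}" by auto
  qed
  have "\<psi> * (v - u) = (n * (v - u) / 2) * (2 * \<psi> / n)" using n0 by simp
  also have "\<dots> \<le> card S * (2 * \<psi> / n)" using cS \<psi> by (intro mult_right_mono) auto
  also have "\<dots> = measure lborel ?U"
    using fin \<psi> n0 by (intro measure_union_spaced_intervals[symmetric]) (auto simp: field_simps)
  also have "\<dots> \<le> measure lborel ({u..<v} \<inter> {t. near \<psi> (real n * t + c)})"
    by (rule measure_mono_fmeasurable[OF sub]) (auto intro!: fmeasurable_Int_fmeasurable)
  finally show ?thesis .
qed

text \<open>Every overlap lies in intervals of radius \<open>x / n\<close> attached to integers
  \<open>a\<close>; as these are the shorter ones, the second condition survives at their centres
  with radius \<open>2 * y\<close>. There it concerns \<open>a * m' / n'\<close> modulo one with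
  \<open>m' / n'\<close> in lowest terms, so \<open>a\<close> is counted in blocks of length
  \<open>n' = n / gcd n m\<close>.\<close>

lemma measure_near_Int_near_le_aux:
  fixes n m :: nat and x y c1 c2 :: real
  assumes n: "n > 0" and m: "m > 0" and x: "0 \<le> x" "x \<le> 1/2" and y: "0 \<le> y"
    and xy: "x / n \<le> y / m"
  shows "measure lborel ({0..<1} \<inter> {t. near x (real n * t + c1) \<and> near y (real m * t + c2)})
    \<le> 32 * x * y + 8 * gcd n m * (x / n)"
proof -
  define d where "d = gcd n m"
  obtain n' m' where n': "n = d * n'" and m': "m = d * m'" and cop: "coprime n' m'"
    using n by (metis d_def gcd_coprime_exists gcd_nat.eq_neutr_iff mult.commute not_gr_zero)
  have d0: "d > 0" and n0: "n' > 0" and m0: "m' > 0" using n m n' m' by auto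
  define c where "c = c2 - c1 * m / n"
  \<comment> \<open>A relevant \<open>a\<close> takes one of at most \<open>n + 2 <= 3 * n\<close>
    values; a range of length \<open>3 * n\<close> consists of exactly \<open>3 * d\<close> blocks
    of length \<open>n'\<close>.\<close>
  define S where "S = {a \<in> {\<lfloor>c1\<rfloor>..<\<lfloor>c1\<rfloor> + int (3 * n)}. near (2 * y) (of_int a * of_int (int m') / real n' + c)}"
  have quot: "real m / real n = real m' / real n'" using d0 by (simp add: n' m')
  have cS: "real (card S) \<le> 16 * y * n + 4 * d"
  proof -
    have "real (card S) \<le> (real (3 * n) / real n' + 1) * (2 * (2 * y) * real n' + 1)"
      unfolding S_def
    proof (rule card_filter_blocks_le[OF n0])
      show "real (card {j \<in> {j0..<j0 + int n'}. near (2 * y) (of_int j * of_int (int m') / real n' + c)})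
          \<le> 2 * (2 * y) * real n' + 1" for j0
        using cop y by (intro card_near_block_le n0) (auto simp: coprime_commute)
    qed (use y in auto)
    also have "real (3 * n) / real n' + 1 = 3 * real d + 1" using n0 by (simp add: n')
    also have "(3 * real d + 1) * (2 * (2 * y) * real n' + 1) \<le> (4 * real d) * (2 * (2 * y) * real n' + 1)"
      using d0 y by (intro mult_right_mono) auto
    also have "\<dots> = 16 * y * n + 4 * d" by (simp add: n' algebra_simps)
    finally show ?thesis .
  qed
  let ?I = "\<lambda>a::int. {(of_int a - c1 - x) / n..(of_int a - c1 + x) / n}"
  let ?A = "{0..<1} \<inter> {t. near x (real n * t + c1) \<and> near y (real m * t + c2)}"
  have fin: "finite S" by (simp add: S_def)
  have sub: "?A \<subseteq> (\<Union>a\<in>S. ?I a)"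
  proof
    fix t assume t: "t \<in> ?A"
    then obtain a :: int where a: "\<bar>n * t + c1 - of_int a\<bar> \<le> x" by (auto simp: near_def)
    have "0 \<le> n * t" "n * t < n" using t n by auto
    then have "of_int \<lfloor>c1\<rfloor> - 1 < real_of_int a" "real_of_int a < real_of_int \<lfloor>c1\<rfloor> + real n + 2" using a x by linarith+
    then have "of_int (\<lfloor>c1\<rfloor> - 1) < real_of_int a" "real_of_int a < of_int (\<lfloor>c1\<rfloor> + int n + 2)" by simp_all
    then have "\<lfloor>c1\<rfloor> - 1 < a" "a < \<lfloor>c1\<rfloor> + int n + 2" unfolding of_int_less_iff by auto
    then have "a \<in> {\<lfloor>c1\<rfloor>..<\<lfloor>c1\<rfloor> + int (3 * n)}" using n by auto
    moreover have "near (2 * y) (of_int a * of_int (int m') / real n' + c)"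
    proof (rule near_perturb)
      show "near y (m * t + c2)" using t by auto
      have "of_int a * of_int (int m') / real n' + c - (m * t + c2) = - (m / n) * (n * t + c1 - of_int a)"
      proof -
        have "of_int a * of_int (int m') / real n' = (m / n) * of_int a" by (simp add: quot)
        then show ?thesis using n by (simp add: c_def field_simps)
      qed
      then have "\<bar>of_int a * of_int (int m') / real n' + c - (m * t + c2)\<bar> = (m / n) * \<bar>n * t + c1 - of_int a\<bar>"
        by (simp add: abs_mult)
      also have "\<dots> \<le> (m / n) * x" using a by (intro mult_left_mono) auto
      also have "\<dots> \<le> y" using xy m n by (simp add: field_simps)
      finally show "\<bar>of_int a * of_int (int m') / real n' + c - (m * t + c2)\<bar> \<le> y" .
    qed simp
    ultimately have "a \<in> S" by (simp add: S_def)
    moreover have "t \<in> ?I a" using a n by (auto simp: field_simps abs_le_iff)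
    ultimately show "t \<in> (\<Union>a\<in>S. ?I a)" by blast
  qed
  have "measure lborel ?A \<le> measure lborel (\<Union>a\<in>S. ?I a)"
  proof (rule measure_mono_fmeasurable[OF sub])
    have "?A = {0..<1} \<inter> {t. near x (real n * t + c1)} \<inter> {t. near y (real m * t + c2)}" by auto
    then show "?A \<in> sets lborel" by simp
    show "(\<Union>a\<in>S. ?I a) \<in> fmeasurable lborel"
      using fin by (intro fmeasurable.finite_UN) auto
  qed
  also have "\<dots> \<le> (\<Sum>a\<in>S. measure lborel (?I a))" using fin by (intro measure_UNION_le) auto
  also have "\<dots> = (\<Sum>a\<in>S. 2 * x / n)" using x n by (intro sum.cong) (auto simp: field_simps)
  also have "\<dots> = card S * (2 * x / n)" by simp
  also have "\<dots> \<le> (16 * y * n + 4 * d) * (2 * x / n)" using cS x by (intro mult_right_mono) auto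
  also have "\<dots> = 32 * x * y + 8 * d * (x / n)" using n by (simp add: field_simps)
  finally show ?thesis by (simp add: d_def)
qed

lemma measure_near_Int_near_le:
  fixes n m :: nat and x y c1 c2 :: real
  assumes n: "n > 0" and m: "m > 0" and x: "0 \<le> x" "x \<le> 1/2" and y: "0 \<le> y" "y \<le> 1/2"
  shows "measure lborel ({0..<1} \<inter> {t. near x (real n * t + c1) \<and> near y (real m * t + c2)})
    \<le> 32 * x * y + 8 * gcd n m * min (x / n) (y / m)"
proof (cases "x / n \<le> y / m")
  case True
  then show ?thesis using measure_near_Int_near_le_aux[OF n m x y(1) True] by (simp add: min_def)
next
  case False
  then have "measure lborel ({0..<1} \<inter> {t. near y (real m * t + c2) \<and> near x (real n * t + c1)})
    \<le> 32 * y * x + 8 * gcd m n * (y / m)"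
    by (intro measure_near_Int_near_le_aux) (use assms in auto)
  then show ?thesis using False by (simp add: min_def conj_commute gcd.commute mult.commute mult.left_commute)
qed

text \<open>Modulo one, \<open>d * \<alpha>\<close> runs through a shift of the grid \<open>b / Q\<close> up to an error \<open>1 / Q\<close>;
  thickening the grid points to cells reduces the count to the overlap measure with radii tripled.\<close>

lemma card_near_both_block_le:
  fixes p d0 :: int and Q u v :: nat and \<alpha> \<delta> \<delta>' c1 c2 :: real
  assumes Q: "Q > 0" and cop: "coprime p (int Q)" and \<alpha>: "real Q * \<bar>\<alpha> - of_int p / real Q\<bar> \<le> 1 / real Q"
    and uv: "coprime u v" "u > 0" "v > 0"
    and u\<delta>: "real u \<le> \<delta> * Q" and v\<delta>: "real v \<le> \<delta>' * Q" and \<delta>: "\<delta> \<le> 1/6" "\<delta>' \<le> 1/6"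
  shows "real (card {d \<in> {d0..<d0 + int Q}. near \<delta> (of_int d * (real u * \<alpha>) + c1) \<and> near \<delta>' (of_int d * (real v * \<alpha>) + c2)})
    \<le> real Q * (288 * \<delta> * \<delta>' + 24 * min (\<delta> / u) (\<delta>' / v))"
proof -
  define S where "S = {d \<in> {d0..<d0 + int Q}. near \<delta> (of_int d * (real u * \<alpha>) + c1) \<and> near \<delta>' (of_int d * (real v * \<alpha>) + c2)}"
  \<comment> \<open>Since \<open>p\<close> is invertible modulo \<open>Q\<close>, distinct
    \<open>d\<close> of a block occupy distinct cells with left end \<open>b d / Q\<close> and
    length \<open>1 / Q\<close>.\<close>
  define b where "b d = (d * p) mod int Q" for d
  define k1 where "k1 = of_int d0 * (real u * \<alpha>) - of_int d0 * (real u * (of_int p / Q)) + c1"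
  define k2 where "k2 = of_int d0 * (real v * \<alpha>) - of_int d0 * (real v * (of_int p / Q)) + c2"
  have fin: "finite S" by (simp add: S_def)
  have inj: "inj_on b S"
  proof (rule inj_onI)
    fix i j assume ij: "i \<in> S" "j \<in> S" and "b i = b j"
    then have "int Q dvd i * p - j * p" unfolding b_def by (simp add: mod_eq_dvd_iff)
    then have "int Q dvd (i - j) * p" by (simp add: algebra_simps)
    then have "int Q dvd i - j" using cop by (simp add: coprime_commute coprime_dvd_mult_left_iff)
    then show "i = j" using ij eq_of_dvd_diff_block[of i d0 Q j] by (auto simp: S_def)
  qed
  \<comment> \<open>The radius triples: one \<open>z\<close> is spent on replacing
    \<open>\<alpha>\<close> by \<open>p / Q\<close> along the block, another on moving from the grid
    point to an arbitrary \<open>t\<close> in its cell.\<close>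
  have pt: "near (3 * z) (real w * t + (of_int d0 * (real w * \<alpha>) - of_int d0 * (real w * (of_int p / Q)) + c))"
    if d: "d \<in> {d0..<d0 + int Q}" and nr: "near z (of_int d * (real w * \<alpha>) + c)" and w: "real w \<le> z * Q"
      and t: "(1/Q) * of_int (b d) \<le> t" "t \<le> (1/Q) * of_int (b d) + 1/Q" for d :: int and w :: nat and z t c :: real
  proof -
    let ?k = "of_int d0 * (real w * \<alpha>) - of_int d0 * (real w * (of_int p / Q)) + c"
    have wz: "real w / Q \<le> z" using w Q by (simp add: field_simps)
    have "near (2 * z) (of_int d * (real w * (of_int p / Q)) + ?k)"
    proof (rule near_block_perturb[OF d _ nr])
      have "real Q * \<bar>real w * \<alpha> - real w * (of_int p / Q)\<bar> = real w * (real Q * \<bar>\<alpha> - of_int p / Q\<bar>)"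
      proof -
        have "real w * \<alpha> - real w * (of_int p / Q) = real w * (\<alpha> - of_int p / Q)" by (simp add: right_diff_distrib)
        then show ?thesis by (simp only: abs_mult abs_of_nat) simp
      qed
      also have "\<dots> \<le> real w * (1 / Q)" using \<alpha> by (intro mult_left_mono) auto
      finally show "real Q * \<bar>real w * \<alpha> - real w * (of_int p / Q)\<bar> \<le> z" using wz by simp
    qed simp
    moreover have "of_int d * (real w * (of_int p / Q)) + ?k
        = (real w * ((1/Q) * of_int (b d)) + ?k) + of_int (int w * ((d * p) div int Q))"
    proof -
      have "d * p = b d + int Q * ((d * p) div int Q)" by (simp add: b_def)
      then have "real_of_int (d * p) = of_int (b d) + real Q * of_int ((d * p) div int Q)"
        by (metis of_int_add of_int_mult of_int_of_nat_eq)
      then have "of_int d * (of_int p / Q) = (1/Q) * of_int (b d) + of_int ((d * p) div int Q)"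
        using Q by (simp add: field_simps)
      then have "real w * (of_int d * (of_int p / Q)) = real w * ((1/Q) * of_int (b d) + of_int ((d * p) div int Q))" by simp
      then show ?thesis by (simp add: algebra_simps)
    qed
    ultimately have "near (2 * z) (real w * ((1/Q) * of_int (b d)) + ?k)" by (simp only: near_add_int)
    then show ?thesis
    proof (rule near_perturb)
      have "\<bar>real w * t + ?k - (real w * ((1/Q) * of_int (b d)) + ?k)\<bar> = real w * \<bar>t - (1/Q) * of_int (b d)\<bar>"
      proof -
        have "real w * t + ?k - (real w * ((1/Q) * of_int (b d)) + ?k) = real w * (t - (1/Q) * of_int (b d))"
          by (simp only: right_diff_distrib add_diff_cancel_right)
        then show ?thesis by (simp only: abs_mult abs_of_nat)
      qed
      also have "\<dots> \<le> real w * (1/Q)" using t by (intro mult_left_mono) auto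
      finally show "\<bar>real w * t + ?k - (real w * ((1/Q) * of_int (b d)) + ?k)\<bar> \<le> z" using wz by simp
    qed simp
  qed
  let ?A = "{0..<1} \<inter> {t. near (3 * \<delta>) (real u * t + k1) \<and> near (3 * \<delta>') (real v * t + k2)}"
  let ?U = "\<Union>a\<in>b ` S. {(1/Q) * of_int a + 0..<(1/Q) * of_int a + 0 + 1/Q}"
  have sub: "?U \<subseteq> ?A"
  proof
    fix t assume "t \<in> ?U"
    then obtain d where d: "d \<in> S" and t: "(1/Q) * of_int (b d) \<le> t" "t < (1/Q) * of_int (b d) + 1/Q" by auto
    have b: "0 \<le> b d" "b d < int Q" using Q by (simp_all add: b_def)
    have "real_of_int (b d) + 1 \<le> Q" using b(2) by linarith
    then have "(1/Q) * of_int (b d) + 1/Q \<le> 1" using Q by (simp add: field_simps)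
    moreover have "0 \<le> (1/Q) * of_int (b d)" using b by simp
    ultimately have "0 \<le> t" "t < 1" using t by linarith+
    moreover have "near (3 * \<delta>) (real u * t + k1)"
      unfolding k1_def by (rule pt[OF _ _ u\<delta> t(1)]) (use d t in \<open>auto simp: S_def\<close>)
    moreover have "near (3 * \<delta>') (real v * t + k2)"
      unfolding k2_def by (rule pt[OF _ _ v\<delta> t(1)]) (use d t in \<open>auto simp: S_def\<close>)
    ultimately show "t \<in> ?A" by auto
  qed
  have "card S * (1 / Q) = card (b ` S) * (1 / Q)" by (simp add: card_image[OF inj])
  also have "\<dots> = measure lborel ?U"
    using fin Q by (intro measure_union_spaced_intervals[symmetric]) auto
  also have "\<dots> \<le> measure lborel ?A"
  proof (rule measure_mono_fmeasurable[OF sub])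
    have "?A = {0..<1} \<inter> ({t. near (3 * \<delta>) (real u * t + k1)} \<inter> {t. near (3 * \<delta>') (real v * t + k2)})" by auto
    then show "?A \<in> fmeasurable lborel" by (auto intro!: fmeasurable_Int_fmeasurable)
  qed auto
  also have "\<dots> \<le> 32 * (3 * \<delta>) * (3 * \<delta>') + 8 * gcd u v * min (3 * \<delta> / u) (3 * \<delta>' / v)"
  proof (rule measure_near_Int_near_le)
    have "0 \<le> \<delta> * Q" "0 \<le> \<delta>' * Q" using u\<delta> v\<delta> of_nat_0_le_iff order_trans by blast+
    then show "0 \<le> 3 * \<delta>" "0 \<le> 3 * \<delta>'" using Q by (simp_all add: zero_le_mult_iff)
  qed (use uv \<delta> in auto)
  also have "\<dots> = 288 * \<delta> * \<delta>' + 24 * min (\<delta> / u) (\<delta>' / v)"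
    using uv by (auto simp: min_def)
  finally have "card S * (1 / Q) \<le> 288 * \<delta> * \<delta>' + 24 * min (\<delta> / u) (\<delta>' / v)" .
  then show ?thesis using Q by (simp add: S_def field_simps)
qed

lemma card_near_both_le:
  fixes p x :: int and Q u v Y :: nat and \<alpha> \<delta> \<delta>' c1 c2 :: real
  assumes Q: "Q > 0" and cop: "coprime p (int Q)" and \<alpha>: "real Q * \<bar>\<alpha> - of_int p / real Q\<bar> \<le> 1 / real Q"
    and uv: "coprime u v" "u > 0" "v > 0"
    and u\<delta>: "real u \<le> \<delta> * Q" and v\<delta>: "real v \<le> \<delta>' * Q" and \<delta>: "\<delta> \<le> 1/6" "\<delta>' \<le> 1/6"
    and Y: "Q \<le> Y"
  shows "real (card {d \<in> {x..<x + int Y}. near \<delta> (of_int d * (real u * \<alpha>) + c1) \<and> near \<delta>' (of_int d * (real v * \<alpha>) + c2)})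
    \<le> 2 * real Y * (288 * \<delta> * \<delta>' + 24 * min (\<delta> / u) (\<delta>' / v))"
proof -
  let ?E = "288 * \<delta> * \<delta>' + 24 * min (\<delta> / u) (\<delta>' / v)"
  have "0 \<le> \<delta> * Q" "0 \<le> \<delta>' * Q" using u\<delta> v\<delta> of_nat_0_le_iff order_trans by blast+
  then have d0: "0 \<le> \<delta>" "0 \<le> \<delta>'" using Q by (simp_all add: zero_le_mult_iff)
  then have E0: "0 \<le> ?E" by simp
  have "real (card {d \<in> {x..<x + int Y}. near \<delta> (of_int d * (real u * \<alpha>) + c1) \<and> near \<delta>' (of_int d * (real v * \<alpha>) + c2)})
    \<le> (real Y / real Q + 1) * (real Q * ?E)"
  proof (rule card_filter_blocks_le[OF Q])
    show "0 \<le> real Q * ?E" using E0 by (rule mult_nonneg_nonneg[OF of_nat_0_le_iff])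
  qed (rule card_near_both_block_le[OF assms(1-10)])
  also have "\<dots> \<le> (2 * real Y / real Q) * (real Q * ?E)"
  proof (rule mult_right_mono)
    show "0 \<le> real Q * ?E" using E0 by (rule mult_nonneg_nonneg[OF of_nat_0_le_iff])
  qed (use Q Y in \<open>simp add: field_simps\<close>)
  also have "\<dots> = 2 * real Y * ?E" using Q by simp
  finally show ?thesis .
qed

section \<open>Greatest common divisors in Bohr sets\<close>

lemma sum_two_sided_geometric_le:
  fixes s :: real
  assumes "s > 0"
  shows "(\<Sum>k<n. min (s * 2 ^ k) (1 / (s * 2 ^ k))) \<le> 6"
proof -
  \<comment> \<open>\<open>min x (1 / x)\<close> is dominated by the increments of this bounded increasing function.\<close>
  define g where "g x = x / (1 + x)" for x :: real
  have step: "min x (1 / x) \<le> 6 * (g (2 * x) - g x)" if "x > 0" for x :: real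
  proof -
    have eq: "g (2 * x) - g x = x / ((1 + x) * (1 + 2 * x))"
      using that by (simp add: g_def field_simps)
    show ?thesis
    proof (cases "x \<le> 1")
      case True
      have "(1 + x) * (1 + 2 * x) \<le> 2 * 3" using that True by (intro mult_mono) auto
      then have "x * ((1 + x) * (1 + 2 * x)) \<le> x * 6" using that by (intro mult_left_mono) auto
      moreover have "0 < (1 + x) * (1 + 2 * x)" using that by simp
      ultimately have "x \<le> x * 6 / ((1 + x) * (1 + 2 * x))" by (simp only: pos_le_divide_eq)
      then have "x \<le> 6 * (x / ((1 + x) * (1 + 2 * x)))" by (metis mult.commute times_divide_eq_right)
      then show ?thesis unfolding eq by linarith
    next
      case False
      have "(1 + x) * (1 + 2 * x) \<le> (2 * x) * (3 * x)" using False by (intro mult_mono) auto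
      then have "1 / x \<le> 6 * (x / ((1 + x) * (1 + 2 * x)))" using that by (simp add: field_simps power2_eq_square)
      then show ?thesis unfolding eq by linarith
    qed
  qed
  have "(\<Sum>k<n. min (s * 2 ^ k) (1 / (s * 2 ^ k))) \<le> (\<Sum>k<n. 6 * (g (s * 2 ^ Suc k) - g (s * 2 ^ k)))"
    using step[of "s * 2 ^ k" for k] assms by (intro sum_mono) (simp add: mult.left_commute mult.commute)
  also have "\<dots> = 6 * (g (s * 2 ^ n) - g s)"
    unfolding sum_distrib_left[symmetric] sum_lessThan_telescope[of "\<lambda>k. g (s * 2 ^ k)" n] by simp
  also have "\<dots> \<le> 6"
  proof -
    have "0 < s * 2 ^ n" using assms by simp
    then have "g (s * 2 ^ n) \<le> 1" by (simp add: g_def)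
    moreover have "0 \<le> g s" using assms by (simp add: g_def)
    ultimately show ?thesis by simp
  qed
  finally show ?thesis .
qed

lemma harm_le_ln:
  assumes "n > 0"
  shows "harm n \<le> 1 + ln (real n)"
proof -
  obtain k where k: "n = Suc k" using assms by (cases n) auto
  show ?thesis using decseqD[OF decseq_harm_diff_ln, of 0 k] by (simp add: k harm_def)
qed

lemma sum_inverse_le_harm:
  assumes "S \<subseteq> {1..n}"
  shows "(\<Sum>d\<in>S. 1 / real d) \<le> harm n"
proof -
  have "(\<Sum>d\<in>S. 1 / real d) \<le> (\<Sum>d\<in>{1..n}. 1 / real d)"
    using assms by (intro sum_mono2) auto
  then show ?thesis by (simp add: harm_def inverse_eq_divide)
qed

text \<open>The minimum is at most the geometric mean, in which the two scales separate.\<close>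

lemma min_inverse_squares_le:
  fixes a b :: real
  assumes "a > 0" "b > 0"
  shows "min (1 / a ^ 2) (1 / b ^ 2) \<le> 1 / (a * b)"
proof (cases "a \<le> b")
  case True
  have "a * b \<le> b ^ 2" using True assms by (simp add: power2_eq_square)
  then have "1 / b ^ 2 \<le> 1 / (a * b)" using assms by (intro divide_left_mono) auto
  then show ?thesis by linarith
next
  case False
  have "a * b \<le> a ^ 2" using False assms by (simp add: power2_eq_square)
  then have "1 / a ^ 2 \<le> 1 / (a * b)" using assms by (intro divide_left_mono) auto
  then show ?thesis by linarith
qed

text \<open>Comparison with an integral: the partial sums stay below \<open>3 - 2 / sqrt n\<close>,
  by the telescoping estimate \<open>1 / b ^ 3 <= 2 / a - 2 / b\<close> for the roots
  \<open>a\<close>, \<open>b\<close> of consecutive integers.\<close>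

lemma sum_inverse_three_halves_le:
  "(\<Sum>u\<in>{1..n}. 1 / (real u * sqrt (real u))) \<le> 3"
proof -
  have "(\<Sum>u\<in>{1..Suc n}. 1 / (real u * sqrt (real u))) \<le> 3 - 2 / sqrt (Suc n)" for n
  proof (induction n)
    case (Suc n)
    define a b where "a = sqrt (Suc n)" and "b = sqrt (Suc (Suc n))"
    have a: "a > 0" "a^2 = Suc n" and b: "b > 0" "b^2 = Suc (Suc n)" by (simp_all add: a_def b_def)
    have ab: "a \<le> b" by (simp add: a_def b_def)
    have "(b - a) * (b + a) = 1" using a b by (simp add: algebra_simps power2_eq_square)
    moreover have "(b - a) * (b + a) \<le> (b - a) * (2 * b)" using ab by (intro mult_left_mono) auto
    ultimately have "1 \<le> 2 * b * (b - a)" by (simp add: algebra_simps)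
    moreover have "a * 1 \<le> b * (2 * b * (b - a))"
      using calculation ab a b by (intro mult_mono) auto
    ultimately have "1 / (b^2 * b) \<le> 2 / a - 2 / b"
      using a(1) b(1) by (simp add: field_simps power2_eq_square)
    then have "1 / (real (Suc (Suc n)) * b) \<le> 2 / a - 2 / b" using b by simp
    then show ?case using Suc by (simp add: a_def b_def)
  qed simp
  from this[of "n - 1"] show ?thesis by (cases n) (simp, smt (verit) diff_Suc_1 divide_nonneg_nonneg of_nat_0_le_iff real_sqrt_ge_0_iff)
qed

lemma card_filter_int:
  "card {n \<in> {x..<x + Y}. P (int n)} = card {j \<in> {int x..<int x + int Y}. P j}"
proof -
  have "int ` {n \<in> {x..<x + Y}. P (int n)} = {j \<in> {int x..<int x + int Y}. P j}"
  proof (intro subset_antisym subsetI)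
    fix j assume j: "j \<in> {j \<in> {int x..<int x + int Y}. P j}"
    then show "j \<in> int ` {n \<in> {x..<x + Y}. P (int n)}" by (intro image_eqI[of _ _ "nat j"]) auto
  qed auto
  then show ?thesis by (metis (no_types, lifting) card_image inj_on_of_nat)
qed

section \<open>Scales attached to one rational approximation\<close>

text \<open>Here \<open>p / Q\<close> is within \<open>1 / Q\<^sup>2\<close> of
  \<open>\<alpha>\<close>, and \<open>t\<close> is the integer part of \<open>log2 Q / 20\<close>.
  The bound \<open>24 <= t\<close> lets additive constants be absorbed into multiples of
  \<open>t\<close> or powers \<open>2 ^ t\<close>.\<close>

locale approx_block =
  fixes \<alpha> \<gamma> :: real and p :: int and Q t :: nat
  assumes cop: "coprime p (int Q)"
    and approx: "real Q * \<bar>\<alpha> - of_int p / real Q\<bar> \<le> 1 / real Q"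
    and Q_ge: "2 ^ (20 * t) \<le> Q" and Q_less: "Q < 2 ^ (20 * (t + 1))"
    and t_ge: "24 \<le> t"
begin

text \<open>The set \<open>B i j\<close> is a Bohr set in a dyadic block; the indices range over \<open>i, j < t\<close>, so that
  \<open>\<delta> j\<close> is at least \<open>1 / q\<close> and \<open>N i\<close> is at least \<open>Q\<^sup>2\<close>. Greatest common divisors are split at
  \<open>Q\<^sup>2 / R\<close>.\<close>

definition q :: nat where "q = 2 ^ (2 * t + 2)"
definition R :: nat where "R = 2 ^ (12 * t)"
definition N :: "nat \<Rightarrow> nat" where "N i = Q\<^sup>2 * 2 ^ i"
definition \<delta> :: "nat \<Rightarrow> real" where "\<delta> j = 1 / 4 ^ (j + 2)"
definition B :: "nat \<Rightarrow> nat \<Rightarrow> nat set" where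
  "B i j = {n \<in> {N i..<2 * N i}. near (\<delta> j) (real n * \<alpha> - \<gamma>)}"

lemma Q_pos: "Q > 0" using Q_ge by (metis gr0I not_one_le_zero one_le_numeral one_le_power order_trans)
lemma q_pos: "q > 0" by (simp add: q_def)
lemma R_pos: "R > 0" by (simp add: R_def)
lemma N_pos: "N i > 0" using Q_pos by (simp add: N_def)
lemma Q2_le_N: "Q\<^sup>2 \<le> N i" by (simp add: N_def)
lemma \<delta>_pos: "\<delta> j > 0" by (simp add: \<delta>_def)
lemma \<delta>_le: "\<delta> j \<le> 1 / 16"
proof -
  have "(4::real)^2 \<le> 4 ^ (j + 2)" by (intro power_increasing) auto
  then show ?thesis by (simp add: \<delta>_def field_simps)
qed
lemma \<delta>_ge: "j < t \<Longrightarrow> 1 / real q \<le> \<delta> j"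
proof -
  assume "j < t"
  then have "(2::real) ^ (2 * (j + 2)) \<le> 2 ^ (2 * t + 2)" by (intro power_increasing) auto
  then have "(4::real) ^ (j + 2) \<le> real q" by (simp add: q_def power_mult)
  then show ?thesis using q_pos by (simp add: \<delta>_def field_simps)
qed

text \<open>This records the room left by the exponents, \<open>15 * t + 2 <= 20 * t\<close>. For
  \<open>j < t\<close> it makes \<open>\<delta> j * Q\<close> large and keeps cofactors up to
  \<open>R * 2 ^ t\<close> below it.\<close>

lemma q_R_le: "R * 2 ^ t * q \<le> Q"
proof -
  have "R * 2 ^ t * q = 2 ^ (12 * t + t + (2 * t + 2))" by (simp only: R_def q_def power_add)
  also have "\<dots> \<le> 2 ^ (20 * t)" using t_ge by (intro power_increasing) auto
  also have "\<dots> \<le> Q" by (rule Q_ge)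
  finally show ?thesis .
qed

lemma R_le: "R \<le> Q"
proof -
  have "1 \<le> 2 ^ t * q" using q_pos by (simp add: Suc_leI)
  then have "R * 1 \<le> R * (2 ^ t * q)" by (rule mult_le_mono2)
  also have "\<dots> \<le> Q" using q_R_le by (simp only: mult.assoc)
  finally show ?thesis by simp
qed

lemma q_le: "q \<le> R"
  unfolding q_def R_def using t_ge by (intro power_increasing) auto

lemma ln_Q_le: "ln (real Q) \<le> 20 * (real t + 1)"
proof -
  have "real Q \<le> real (2 ^ (20 * (t + 1)))" using Q_less by (intro of_nat_mono) simp
  then have "real Q \<le> 2 ^ (20 * (t + 1))" by (simp only: of_nat_power of_nat_numeral)
  then have "ln (real Q) \<le> ln (2 ^ (20 * (t + 1)))" using Q_pos by (intro ln_mono) simp_all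
  also have "\<dots> = 20 * (real t + 1) * ln 2" by (simp add: ln_realpow algebra_simps)
  also have "\<dots> \<le> 20 * (real t + 1) * 1" using ln_le_minus_one[of 2] by (intro mult_left_mono) auto
  finally show ?thesis by simp
qed

lemma card_B_eq: "card (B i j) = card {k \<in> {int (N i)..<int (N i) + int (N i)}. near (\<delta> j) (of_int k * \<alpha> + - \<gamma>)}"
proof -
  have *: "B i j = {n \<in> {N i..<N i + N i}. near (\<delta> j) (of_int (int n) * \<alpha> + - \<gamma>)}"
    unfolding B_def mult_2 by simp
  show ?thesis unfolding * by (rule card_filter_int)
qed

text \<open>\<open>N i\<close> is a multiple of \<open>Q\<close>, so the range splits exactly into
  blocks of length \<open>Q\<close>; the progression bound applies because
  \<open>4 * q <= Q\<close>.\<close>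

lemma card_B_ge:
  assumes "j < t"
  shows "\<delta> j * N i \<le> card (B i j)"
proof -
  have "3 \<le> \<delta> j * Q"
  proof -
    have "(2::nat) ^ 2 \<le> 2 ^ t" using t_ge by (intro power_increasing) auto
    also have "\<dots> \<le> R * 2 ^ t" using R_pos by simp
    finally have "2 ^ 2 * q \<le> R * 2 ^ t * q" by (rule mult_le_mono1)
    also have "\<dots> \<le> Q" by (rule q_R_le)
    finally have "4 * q \<le> Q" by simp
    then have "real (4 * q) \<le> Q" by (rule of_nat_mono)
    then have "4 \<le> (1 / q) * Q" using q_pos by (simp add: field_simps)
    also have "\<dots> \<le> \<delta> j * Q" using \<delta>_ge[OF assms] by (intro mult_right_mono) auto
    finally show ?thesis by simp
  qed
  moreover have "\<delta> j \<le> 1 / 2" using \<delta>_le[of j] by simp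
  ultimately have "\<delta> j * real (Q * (Q * 2 ^ i)) \<le>
     real (card {k \<in> {int (N i)..<int (N i) + int (Q * (Q * 2 ^ i))}. near (\<delta> j) (of_int k * \<alpha> + - \<gamma>)})"
    by (intro card_near_progression_ge[OF Q_pos cop approx])
  moreover have "Q * (Q * 2 ^ i) = N i" by (simp add: N_def power2_eq_square)
  ultimately show ?thesis by (simp add: card_B_eq)
qed

section \<open>Good and bad divisors\<close>

text \<open>For good \<open>d\<close> the multiples of \<open>d\<close> have at most the expected density in every set \<open>B i j\<close>,
  because \<open>d * \<alpha>\<close> has a rational approximation whose denominator \<open>r\<close> exceeds \<open>1 / \<delta> j\<close> but is
  shorter than the range of \<open>n / d\<close>.\<close>

definition good :: "nat \<Rightarrow> bool" where
  "good d \<longleftrightarrow> (\<exists>(a::int) (r::nat). coprime a (int r) \<and> q \<le> r \<and> r * d \<le> Q\<^sup>2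
      \<and> real r * \<bar>real d * \<alpha> - of_int a / real r\<bar> \<le> 1 / real q)"

lemma card_B_multiples_le:
  assumes d: "d > 0" "2 * d \<le> Q\<^sup>2" and j: "j < t"
  shows "real (card {n \<in> B i j. d dvd n}) \<le> 2 * N i / d"
    and "good d \<Longrightarrow> real (card {n \<in> B i j. d dvd n}) \<le> 20 * \<delta> j * N i / d"
proof -
  define x where "x = N i div d"
  \<comment> \<open>For \<open>n = d * k < 2 * N i\<close> one obtains only
    \<open>k < 2 * x + 2\<close>, whence the length \<open>x + 2\<close>.\<close>
  define Y where "Y = x + 2"
  have Nx: "N i = d * x + N i mod d" "N i mod d < d" using d by (simp_all add: x_def)
  have "2 \<le> x" unfolding x_def using d Q2_le_N[of i]
    by (metis div_le_mono nonzero_mult_div_cancel_right not_gr_zero order_trans)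
  then have "real Y \<le> 2 * real x" by (simp add: Y_def)
  also have "\<dots> \<le> 2 * (N i / d)" unfolding x_def by (intro mult_left_mono of_nat_div_le_of_nat) auto
  finally have Y: "real Y \<le> 2 * (N i / d)" .
  let ?K = "{k \<in> {int x..<int x + int Y}. near (\<delta> j) (of_int k * (real d * \<alpha>) + - \<gamma>)}"
  have le: "card {n \<in> B i j. d dvd n} \<le> card ?K"
  proof -
    have "{n \<in> B i j. d dvd n} \<subseteq> (*) d ` {k \<in> {x..<x + Y}. near (\<delta> j) (of_int (int k) * (real d * \<alpha>) + - \<gamma>)}"
    proof
      fix n assume n: "n \<in> {n \<in> B i j. d dvd n}"
      then obtain k where k: "n = d * k" by (auto elim: dvdE)
      have "N i \<le> d * k" "d * k < 2 * N i" using n by (auto simp: B_def k)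
      moreover have "d * (2 * x + 2) = 2 * (d * x) + 2 * d" by (simp add: algebra_simps)
      ultimately have "d * x \<le> d * k" "d * k < d * (2 * x + 2)" using Nx by linarith+
      then have "x \<le> k" "k < 2 * x + 2" using d by (simp_all only: mult_le_cancel1 mult_less_cancel1)
      then have "x \<le> k" "k < x + Y" by (simp_all add: Y_def)
      then show "n \<in> (*) d ` {k \<in> {x..<x + Y}. near (\<delta> j) (of_int (int k) * (real d * \<alpha>) + - \<gamma>)}"
        using n k by (intro image_eqI[where x = k]) (auto simp: B_def mult_ac)
    qed
    then have "card {n \<in> B i j. d dvd n} \<le> card {k \<in> {x..<x + Y}. near (\<delta> j) (of_int (int k) * (real d * \<alpha>) + - \<gamma>)}"
      by (rule surj_card_le[rotated]) simp
    also have "\<dots> = card ?K" by (rule card_filter_int)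
    finally show ?thesis .
  qed
  have "card ?K \<le> card {int x..<int x + int Y}" by (rule card_mono) auto
  then have "real (card ?K) \<le> Y" by simp
  then show "real (card {n \<in> B i j. d dvd n}) \<le> 2 * N i / d" using le Y by simp
  assume "good d"
  then obtain a r where r: "coprime a (int r)" "q \<le> r" "r * d \<le> Q\<^sup>2"
    "real r * \<bar>real d * \<alpha> - of_int a / real r\<bar> \<le> 1 / real q" unfolding good_def by blast
  have "r \<le> N i div d" using r(3) Q2_le_N[of i] d by (metis less_eq_div_iff_mult_less_eq order_trans)
  then have rY: "r \<le> Y" by (simp add: Y_def x_def)
  have "1 \<le> (1 / q) * r" using r(2) q_pos by (simp add: field_simps)
  also have "\<dots> \<le> \<delta> j * r" using \<delta>_ge[OF j] by (intro mult_right_mono) auto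
  finally have "real (card ?K) \<le> 10 * \<delta> j * real Y"
    using r \<delta>_ge[OF j] rY q_pos by (intro card_near_progression_le'[of r a]) auto
  also have "\<dots> \<le> 10 * \<delta> j * (2 * (N i / d))" using Y \<delta>_pos[of j] by (intro mult_left_mono) auto
  finally show "real (card {n \<in> B i j. d dvd n}) \<le> 20 * \<delta> j * N i / d" using le by simp
qed

text \<open>For small \<open>d\<close> the fraction \<open>d * p / Q\<close> itself serves: in
  lowest terms its denominator \<open>Q / gcd d Q\<close> is at least \<open>Q / d >= q\<close>, and
  the error of \<open>p / Q\<close> is multiplied only by \<open>d\<close>.\<close>

lemma good_of_le:
  assumes d: "d > 0" "d * q \<le> Q"
  shows "good d"
proof -
  define g where "g = gcd d Q"
  obtain d' r where d': "d = g * d'" and r: "Q = g * r" and co: "coprime d' r"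
    using d by (metis g_def gcd_coprime_exists gcd_nat.eq_neutr_iff mult.commute not_gr_zero)
  have g0: "g > 0" using d by (simp add: g_def)
  have "coprime (p * int d') (int r)"
    using cop co by (auto simp: r coprime_mult_left_iff)
  moreover have "q \<le> r"
  proof -
    have "g * q \<le> d * q" using d by (intro mult_le_mono1) (simp add: g_def gcd_le1_nat)
    then have "g * q \<le> g * r" using d(2) r by linarith
    then show ?thesis using g0 by simp
  qed
  moreover have rQ: "r \<le> Q" using g0 r by simp
  moreover have dQ: "d \<le> Q" using d(2) q_pos by (metis dual_order.trans le_add1 mult.commute mult_eq_if not_gr_zero)
  moreover have "real r * \<bar>real d * \<alpha> - of_int (p * int d') / real r\<bar> \<le> 1 / real q"
  proof -
    have "of_int (p * int d') / real r = real d * (of_int p / Q)" using g0 Q_pos by (simp add: r d')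
    then have "\<bar>real d * \<alpha> - of_int (p * int d') / real r\<bar> = real d * \<bar>\<alpha> - of_int p / Q\<bar>"
      by (metis abs_mult abs_of_nat right_diff_distrib)
    then have "real r * \<bar>real d * \<alpha> - of_int (p * int d') / real r\<bar> = real d * (real r * \<bar>\<alpha> - of_int p / Q\<bar>)" by simp
    also have "\<dots> \<le> real d * (real Q * \<bar>\<alpha> - of_int p / Q\<bar>)" using rQ by (intro mult_left_mono mult_right_mono) auto
    also have "\<dots> \<le> real d * (1 / Q)" using approx by (intro mult_left_mono) auto
    also have "\<dots> \<le> 1 / q"
    proof -
      have "real (d * q) \<le> Q" using d(2) by (rule of_nat_mono)
      then show ?thesis using q_pos Q_pos by (simp add: field_simps)
    qed
    finally show ?thesis .
  qed
  ultimately show ?thesis unfolding good_def power2_eq_square by (meson mult_le_mono)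
qed

text \<open>Dirichlet's theorem approximates \<open>d * \<alpha>\<close> with a denominator at most
  \<open>R\<close>. Since \<open>d * R <= Q\<^sup>2\<close>, a denominator of \<open>q\<close> or
  more would make \<open>d\<close> good.\<close>

lemma bad_imp:
  assumes d: "d > 0" "d * R \<le> Q\<^sup>2" and "\<not> good d"
  shows "\<exists>k. 0 < k \<and> k < q \<and> near (1 / R) (of_int (int (k * d)) * \<alpha> + 0)"
proof -
  obtain h k where hk: "coprime h k" "0 < k" "k \<le> int R" "\<bar>of_int k * (real d * \<alpha>) - of_int h\<bar> < 1 / R"
    using Dirichlet_approx_coprime[OF R_pos] by blast
  define r where "r = nat k"
  have r: "k = int r" "r > 0" "r \<le> R" using hk by (auto simp: r_def)
  have close: "\<bar>real r * (real d * \<alpha>) - of_int h\<bar> < 1 / R" using hk(4) by (simp add: r)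
  have "r < q"
  proof (rule ccontr)
    assume "\<not> r < q"
    moreover have "r * d \<le> Q\<^sup>2" using r(3) d(2) by (metis mult.commute mult_le_mono2 order_trans)
    moreover have "real r * \<bar>real d * \<alpha> - of_int h / real r\<bar> = \<bar>real r * (real d * \<alpha>) - of_int h\<bar>"
    proof -
      have "real r * \<bar>real d * \<alpha> - of_int h / real r\<bar> = \<bar>real r * (real d * \<alpha> - of_int h / real r)\<bar>"
        by (simp only: abs_mult abs_of_nat)
      also have "real r * (real d * \<alpha> - of_int h / real r) = real r * (real d * \<alpha>) - of_int h"
        using r(2) by (simp add: right_diff_distrib)
      finally show ?thesis .
    qed
    moreover have "1 / real R \<le> 1 / q" using q_le q_pos by (simp add: frac_le)
    ultimately have "good d" unfolding good_def using hk(1) close r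
      by (intro exI[of _ h] exI[of _ r]) auto
    then show False using assms by simp
  qed
  moreover have "near (1 / R) (of_int (int (r * d)) * \<alpha> + 0)"
    unfolding near_def using close by (intro exI[of _ h]) (auto simp: mult_ac)
  ultimately show ?thesis using r by blast
qed

text \<open>A bad \<open>d\<close> has a multiple \<open>h = k * d\<close> with \<open>k < q\<close> such that \<open>h * \<alpha>\<close> is exceptionally close to
  an integer; such \<open>h\<close> are rare.\<close>

definition H :: "nat set" where
  "H = {h. 0 < h \<and> h < Q * (Q * q) \<and> Q < h * q \<and> near (1 / R) (of_int (int h) * \<alpha> + 0)}"

text \<open>\<open>H\<close> is cut into blocks of length \<open>Q\<close>. As
  \<open>R <= Q\<close>, each contains at most \<open>10 * Q / R\<close> elements by
  equidistribution, and summing the reciprocals over the blocks produces a harmonic sum.\<close>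

lemma sum_H_le: "(\<Sum>h\<in>H. 1 / real h) \<le> 20 * real q / R * harm (Q * q)"
proof -
  define Bl where "Bl l = {h \<in> {l * Q..<l * Q + Q}. near (1 / R) (of_int (int h) * \<alpha> + 0)}" for l
  have finH: "finite H" unfolding H_def by (rule finite_subset[of _ "{..<Q * (Q * q)}"]) auto
  have RQ: "1 / real Q \<le> 1 / R" using R_le R_pos by (simp add: frac_le)
  have cBl: "real (card (Bl l)) \<le> 10 * Q / R" for l
  proof -
    have "real (card (Bl l)) = real (card {j \<in> {int (l * Q)..<int (l * Q) + int Q}. near (1 / R) (of_int j * \<alpha> + 0)})"
      unfolding Bl_def using card_filter_int[of "l * Q" Q "\<lambda>j. near (1 / R) (of_int j * \<alpha> + 0)"] by simp
    also have "\<dots> \<le> (real Q / real Q + 1) * (2 * (1 / R + 1 / Q) * real Q + 1)"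
      using approx by (intro card_near_progression_le[OF Q_pos cop]) auto
    also have "\<dots> = 4 * (Q / R) + 6" using Q_pos by (simp add: field_simps)
    also have "\<dots> \<le> 10 * Q / R" using R_le R_pos by (simp add: field_simps)
    finally show ?thesis .
  qed
  \<comment> \<open>In the first block, \<open>l = 0\<close>, the weight is controlled only by
    \<open>Q < h * q\<close>, which costs the factor \<open>q\<close>.\<close>
  have w: "1 / real h \<le> 2 * q / (real Q * (l + 1))" if "h \<in> H" "h div Q = l" for h l
  proof -
    have h0: "h > 0" using that by (auto simp: H_def)
    have "Q * (l + 1) \<le> 2 * q * h"
    proof (cases "l = 0")
      case True
      have "Q \<le> h * q" using that(1) by (simp add: H_def)
      also have "\<dots> \<le> 2 * q * h" by simp
      finally show ?thesis using True by simp
    next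
      case False
      have "l * Q \<le> h" using that(2) by (metis div_times_less_eq_dividend)
      have "Q * (l + 1) \<le> 2 * (l * Q)" using False by (cases l) auto
      also have "\<dots> \<le> 2 * h" using \<open>l * Q \<le> h\<close> by simp
      also have "\<dots> \<le> 2 * q * h" using q_pos by simp
      finally show ?thesis .
    qed
    then have "real (Q * (l + 1)) \<le> real (2 * q * h)" by (rule of_nat_mono)
    then have "real Q * (real l + 1) \<le> 2 * q * h" by (simp add: algebra_simps)
    moreover have "0 < real Q * (real l + 1)" using Q_pos by simp
    ultimately show ?thesis using h0 by (simp add: divide_le_eq le_divide_eq mult_ac)
  qed
  have "(\<Sum>h\<in>H. 1 / real h) = (\<Sum>l<Q * q. \<Sum>h\<in>{h \<in> H. h div Q = l}. 1 / real h)"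
  proof (rule sum.group[symmetric, OF finH])
    show "(\<lambda>h. h div Q) ` H \<subseteq> {..<Q * q}"
      using Q_pos by (auto simp: H_def less_mult_imp_div_less mult_ac)
  qed simp
  also have "\<dots> \<le> (\<Sum>l<Q * q. (10 * Q / R) * (2 * q / (real Q * (l + 1))))"
  proof (rule sum_mono)
    fix l
    have "{h \<in> H. h div Q = l} \<subseteq> Bl l"
    proof
      fix h assume h: "h \<in> {h \<in> H. h div Q = l}"
      have "h = l * Q + h mod Q" using h div_mult_mod_eq[of h Q] by simp
      moreover have "h mod Q < Q" using Q_pos by simp
      ultimately have "h \<in> {l * Q..<l * Q + Q}" by simp
      then show "h \<in> Bl l" using h by (simp add: Bl_def H_def)
    qed
    then have "card {h \<in> H. h div Q = l} \<le> card (Bl l)" by (rule card_mono[rotated]) (simp add: Bl_def)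
    then have "real (card {h \<in> H. h div Q = l}) \<le> 10 * Q / R" using cBl[of l] by linarith
    moreover have "(\<Sum>h\<in>{h \<in> H. h div Q = l}. 1 / real h) \<le> real (card {h \<in> H. h div Q = l}) * (2 * q / (real Q * (l + 1)))"
    proof (rule sum_bounded_above)
      fix h assume "h \<in> {h \<in> H. h div Q = l}"
      then show "1 / real h \<le> 2 * q / (real Q * (l + 1))" using w[of h l] by (simp add: add.commute)
    qed
    moreover have "real (card {h \<in> H. h div Q = l}) * (2 * q / (real Q * (l + 1))) \<le> (10 * Q / R) * (2 * q / (real Q * (l + 1)))"
      using calculation(1) by (intro mult_right_mono) auto
    ultimately show "(\<Sum>h\<in>{h \<in> H. h div Q = l}. 1 / real h) \<le> (10 * Q / R) * (2 * q / (real Q * (l + 1)))"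
      by linarith
  qed
  also have "\<dots> = (\<Sum>l<Q * q. 20 * real q / R * inverse (real (Suc l)))"
  proof (rule sum.cong[OF refl])
    fix l :: nat
    have *: "(10 * Q / r) * (2 * q / (real Q * y)) = 20 * real q / r * inverse y" if "r > 0" "y > 0" for r y :: real
      using Q_pos that by (simp add: field_simps)
    show "(10 * Q / R) * (2 * q / (real Q * (l + 1))) = 20 * real q / R * inverse (real (Suc l))"
      using *[of R "real l + 1"] R_pos by (simp add: add.commute)
  qed
  also have "\<dots> = 20 * real q / R * harm (Q * q)"
    by (simp add: harm_altdef sum_distrib_left)
  finally show ?thesis .
qed

lemma harm_Qq_le: "harm (Q * q) \<le> 64 * (2 ^ t :: real)"
proof -
  have "q \<le> Q" using q_le R_le by simp
  then have "ln (real q) \<le> ln (real Q)" using q_pos by (intro ln_mono) auto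
  moreover have "ln (real (Q * q)) = ln (real Q) + ln (real q)" using Q_pos q_pos by (simp add: ln_mult)
  moreover have "harm (Q * q) \<le> 1 + ln (real (Q * q))" using Q_pos q_pos by (intro harm_le_ln) simp
  ultimately have "harm (Q * q) \<le> 1 + 40 * (real t + 1)" using ln_Q_le by linarith
  also have "\<dots> \<le> 64 * real t" using t_ge by simp
  also have "\<dots> \<le> 64 * 2 ^ t" by simp
  finally show ?thesis .
qed

text \<open>A bad \<open>d\<close> is charged to a pair \<open>(k, k * d)\<close> with
  \<open>k * d\<close> in \<open>H\<close>, and \<open>1 / d <= q / (k * d)\<close>. The target
  \<open>1 / q\<^sup>2\<close> bounds every \<open>\<delta> j * \<delta> j'\<close> with
  \<open>j, j' < t\<close> from below, so that the trivial count suffices for bad divisors.\<close>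

lemma sum_bad_le:
  assumes S: "finite S" "\<And>d. d \<in> S \<Longrightarrow> d > 0 \<and> d * R \<le> Q\<^sup>2 \<and> \<not> good d"
  shows "(\<Sum>d\<in>S. 1 / real d) \<le> 1 / real q ^ 2"
proof -
  have finH: "finite H" unfolding H_def by (rule finite_subset[of _ "{..<Q * (Q * q)}"]) auto
  have "(\<Sum>d\<in>S. 1 / real d) \<le> (\<Sum>(k, h)\<in>{..<q} \<times> H. real q / real h)"
  proof (rule sum_le_included[where i = "\<lambda>(k, h). h div k"])
    show "\<forall>d\<in>S. \<exists>y\<in>{..<q} \<times> H. (case y of (k, h) \<Rightarrow> h div k) = d \<and> 1 / real d \<le> (case y of (k, h) \<Rightarrow> real q / real h)"
    proof
      fix d assume "d \<in> S"
      then have d: "d > 0" "d * R \<le> Q\<^sup>2" "\<not> good d" using S by auto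
      obtain k where k: "0 < k" "k < q" "near (1 / R) (of_int (int (k * d)) * \<alpha> + 0)"
        using bad_imp[OF d] by blast
      \<comment> \<open>Small \<open>d\<close> are good by \<open>good_of_le\<close>.\<close>
      have "Q < d * q" using good_of_le[of d] d by force
      also have "\<dots> \<le> k * d * q" using k by simp
      finally have Qd: "Q < k * d * q" .
      have "k * d < q * Q\<^sup>2"
      proof -
        have "d * 1 \<le> d * R" using R_pos by (intro mult_le_mono2) simp
        then have "d \<le> Q\<^sup>2" using d(2) by linarith
        then have "k * d \<le> k * Q\<^sup>2" by simp
        also have "\<dots> < q * Q\<^sup>2" using k Q_pos by simp
        finally show ?thesis .
      qed
      then have "k * d \<in> H" using k d Qd by (auto simp: H_def power2_eq_square mult_ac)
      moreover have "1 / real d \<le> real q / real (k * d)"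
        using k d by (simp add: field_simps)
      ultimately show "\<exists>y\<in>{..<q} \<times> H. (case y of (k, h) \<Rightarrow> h div k) = d \<and> 1 / real d \<le> (case y of (k, h) \<Rightarrow> real q / real h)"
        using k by (intro bexI[of _ "(k, k * d)"]) auto
    qed
  qed (use S finH in auto)
  also have "\<dots> = real q * (\<Sum>h\<in>H. real q / real h)"
    by (simp flip: sum.cartesian_product)
  also have "\<dots> = real q ^ 2 * (\<Sum>h\<in>H. 1 / real h)"
    by (simp add: sum_distrib_left power2_eq_square)
  also have "\<dots> \<le> real q ^ 2 * (20 * real q / R * harm (Q * q))"
    by (intro mult_left_mono sum_H_le) auto
  also have "\<dots> \<le> real q ^ 2 * (20 * real q / R * (64 * 2 ^ t))"
    by (intro mult_left_mono harm_Qq_le) auto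
  also have "\<dots> \<le> 1 / real q ^ 2"
  proof -
    have q5: "q ^ 5 = 2 ^ (10 * t + 10)" proof -
      have "q ^ 5 = 2 ^ ((2 * t + 2) * 5)" by (simp only: q_def power_mult)
      also have "(2 * t + 2) * 5 = 10 * t + 10" by simp
      finally show ?thesis .
    qed
    have "1280 * q ^ 5 * 2 ^ t \<le> 2 ^ 11 * q ^ 5 * 2 ^ t" by simp
    also have "\<dots> = 2 ^ 11 * 2 ^ (10 * t + 10) * 2 ^ t" by (simp only: q5)
    also have "2 ^ 11 * 2 ^ (10 * t + 10) * 2 ^ t = (2::nat) ^ (11 + (10 * t + 10) + t)" by (simp only: power_add)
    also have "\<dots> \<le> R" unfolding R_def using t_ge by (intro power_increasing) auto
    finally have "1280 * q ^ 5 * 2 ^ t \<le> R" .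
    then have "real (1280 * q ^ 5 * 2 ^ t) \<le> real R" by (rule of_nat_mono)
    then have "1280 * real q ^ 5 * 2 ^ t \<le> real R" by simp
    then show ?thesis using q_pos R_pos by (simp add: divide_simps power_numeral_reduce mult_ac)
  qed
  finally show ?thesis .
qed

section \<open>Pairs with small greatest common divisor\<close>

text \<open>A pair is charged to \<open>d = gcd n m\<close>, and equality is then relaxed to
  \<open>d\<close> dividing both. Good \<open>d\<close> contribute multiples of
  \<open>1 / d\<close>, whose sum is logarithmic in \<open>Q\<close> and yields the factor
  \<open>t\<close>; for bad \<open>d\<close> the trivial count meets a sum of reciprocals that is
  already at most \<open>\<delta> j * \<delta> j'\<close>.\<close>

lemma sum_small_gcd_le:
  assumes j: "j < t" "j' < t"
  shows "(\<Sum>(n, m)\<in>{(n, m) \<in> B i j \<times> B i' j'. gcd n m * R \<le> Q\<^sup>2}. real (gcd n m))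
    \<le> 40000 * t * N i * N i' * \<delta> j * \<delta> j'"
proof -
  define D where "D = {d. 0 < d \<and> d * R \<le> Q\<^sup>2}"
  have DQ: "D \<subseteq> {1..Q\<^sup>2}" using R_pos unfolding D_def
    by (auto simp: Suc_le_eq) (metis Suc_leI dual_order.trans mult_le_mono2 mult.right_neutral One_nat_def)
  have finD: "finite D" by (rule finite_subset[OF DQ]) simp
  have finB: "finite (B i j)" for i j by (simp add: B_def)
  define b where "b d = card {n \<in> B i j. d dvd n}" for d
  define b' where "b' d = card {n \<in> B i' j'. d dvd n}" for d
  let ?K = "real (N i) * N i' * \<delta> j * \<delta> j'"
  have R2: "2 \<le> R" unfolding R_def using t_ge self_le_power[of 2 "12 * t"] by simp
  have d2: "d > 0" "2 * d \<le> Q\<^sup>2" if "d \<in> D" for d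
  proof -
    show "d > 0" using that by (simp add: D_def)
    have "2 * d \<le> d * R" using R2 by (simp add: mult.commute)
    then show "2 * d \<le> Q\<^sup>2" using that unfolding D_def mem_Collect_eq by linarith
  qed
  have finZ: "finite {(n, m) \<in> B i j \<times> B i' j'. gcd n m * R \<le> Q\<^sup>2}"
    by (rule finite_subset[of _ "B i j \<times> B i' j'"]) (use finB in auto)
  have "(\<Sum>(n, m)\<in>{(n, m) \<in> B i j \<times> B i' j'. gcd n m * R \<le> Q\<^sup>2}. real (gcd n m))
      \<le> (\<Sum>(d, n, m)\<in>(SIGMA d:D. {n \<in> B i j. d dvd n} \<times> {m \<in> B i' j'. d dvd m}). real d)"
  proof (rule sum_le_included[where i = "\<lambda>(d, n, m). (n, m)"])
    show "\<forall>x\<in>{(n, m) \<in> B i j \<times> B i' j'. gcd n m * R \<le> Q\<^sup>2}.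
       \<exists>y\<in>SIGMA d:D. {n \<in> B i j. d dvd n} \<times> {m \<in> B i' j'. d dvd m}.
          (case y of (d, n, m) \<Rightarrow> (n, m)) = x \<and> (case x of (n, m) \<Rightarrow> real (gcd n m)) \<le> (case y of (d, n, m) \<Rightarrow> real d)"
    proof (clarify, goal_cases)
      case (1 n m)
      have "n > 0" using 1 N_pos[of i] by (auto simp: B_def)
      then show ?case using 1 by (intro bexI[of _ "(gcd n m, n, m)"]) (auto simp: D_def)
    qed
  qed (use finZ finD finB in \<open>auto intro!: finite_SigmaI\<close>)
  also have "\<dots> = (\<Sum>d\<in>D. real d * (real (b d) * real (b' d)))"
    using finD finB by (simp add: b_def b'_def card_cartesian_product mult_ac flip: sum.Sigma)
  also have "\<dots> \<le> (\<Sum>d\<in>D. 400 * ?K * (1 / real d) + (if good d then 0 else 4 * real (N i) * N i' * (1 / real d)))"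
  proof (rule sum_mono)
    fix d assume d: "d \<in> D"
    have K: "0 \<le> ?K" using \<delta>_pos[of j] \<delta>_pos[of j'] by simp
    show "real d * (real (b d) * real (b' d)) \<le> 400 * ?K * (1 / real d) + (if good d then 0 else 4 * real (N i) * N i' * (1 / real d))"
    proof (cases "good d")
      case True
      have "real (b d) * real (b' d) \<le> (20 * \<delta> j * N i / d) * (20 * \<delta> j' * N i' / d)"
        unfolding b_def b'_def using d2[OF d] True j \<delta>_pos[of j]
        by (intro mult_mono card_B_multiples_le(2)) auto
      then have "real d * (real (b d) * real (b' d)) \<le> real d * ((20 * \<delta> j * N i / d) * (20 * \<delta> j' * N i' / d))"
        by (intro mult_left_mono) auto
      also have "\<dots> = 400 * ?K * (1 / real d)" using d2[OF d] by (simp add: field_simps)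
      finally show ?thesis using True by simp
    next
      case False
      have "real (b d) * real (b' d) \<le> (2 * N i / d) * (2 * N i' / d)"
        unfolding b_def b'_def using d2[OF d] j
        by (intro mult_mono card_B_multiples_le(1)) auto
      then have "real d * (real (b d) * real (b' d)) \<le> real d * ((2 * N i / d) * (2 * N i' / d))"
        by (intro mult_left_mono) auto
      also have "\<dots> = 4 * real (N i) * N i' * (1 / real d)" using d2[OF d] by (simp add: field_simps)
      finally show ?thesis using False K d2[OF d] by (simp add: add_increasing)
    qed
  qed
  also have "\<dots> = 400 * ?K * (\<Sum>d\<in>D. 1 / real d) + 4 * real (N i) * N i' * (\<Sum>d\<in>{d \<in> D. \<not> good d}. 1 / real d)"
  proof -
    have "(\<Sum>d\<in>D. if good d then 0 else 4 * real (N i) * N i' * (1 / real d))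
        = (\<Sum>d\<in>{d \<in> D. \<not> good d}. 4 * real (N i) * N i' * (1 / real d))"
      by (rule sum.mono_neutral_cong_right[OF finD]) auto
    then show ?thesis by (simp only: sum.distrib sum_distrib_left)
  qed
  also have "\<dots> \<le> 400 * ?K * (81 * t) + 4 * real (N i) * N i' * (\<delta> j * \<delta> j')"
  proof (intro add_mono mult_left_mono)
    have "(\<Sum>d\<in>D. 1 / real d) \<le> harm (Q\<^sup>2)" by (rule sum_inverse_le_harm[OF DQ])
    also have "\<dots> \<le> 1 + ln (real (Q\<^sup>2))" using Q_pos by (intro harm_le_ln) simp
    also have "\<dots> = 1 + 2 * ln (real Q)" using Q_pos by (simp add: ln_realpow)
    also have "\<dots> \<le> 81 * t" using ln_Q_le t_ge by simp
    finally show "(\<Sum>d\<in>D. 1 / real d) \<le> real (81 * t)" by simp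
    have "(\<Sum>d\<in>{d \<in> D. \<not> good d}. 1 / real d) \<le> 1 / real q ^ 2"
    proof (rule sum_bad_le)
      show "finite {d \<in> D. \<not> good d}" using finD by simp
    qed (auto simp: D_def)
    also have "\<dots> = (1 / q) * (1 / q)" by (simp add: power2_eq_square)
    also have "\<dots> \<le> \<delta> j * \<delta> j'" using \<delta>_ge j \<delta>_pos[of j] by (intro mult_mono) auto
    finally show "(\<Sum>d\<in>{d \<in> D. \<not> good d}. 1 / real d) \<le> \<delta> j * \<delta> j'" .
  qed (use \<delta>_pos[of j] \<delta>_pos[of j'] in auto)
  also have "\<dots> = (32400 * t + 4) * ?K" by (simp add: algebra_simps)
  also have "\<dots> \<le> (40000 * t) * ?K"
    using t_ge \<delta>_pos[of j] \<delta>_pos[of j'] by (intro mult_right_mono) auto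
  finally show ?thesis by (simp add: mult_ac)
qed

section \<open>Pairs with large greatest common divisor\<close>

text \<open>The cofactor pairs \<open>(u, v)\<close> of \<open>n = d * u\<close> and \<open>m = d * v\<close> with \<open>d\<close> large: they are so small
  that, for a fixed pair, \<open>d\<close> runs through whole blocks of length \<open>Q\<close>.\<close>

definition W :: "nat \<Rightarrow> nat \<Rightarrow> (nat \<times> nat) set" where
  "W i i' = {(u, v) \<in> {1..R * 2 ^ t} \<times> {1..R * 2 ^ t}. N i * v < 2 * N i' * u \<and> N i' * u < 2 * N i * v}"

lemma finite_W [simp]: "finite (W i i')"
  unfolding W_def by (rule finite_subset[of _ "{1..R * 2 ^ t} \<times> {1..R * 2 ^ t}"]) auto

lemma finite_B [simp]: "finite (B i j)"
  by (simp add: B_def)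

text \<open>For fixed \<open>u\<close> the ratio condition confines \<open>v\<close> to the range
  from \<open>y / 2\<close> to \<open>2 * y\<close>, so the inner sum of reciprocals is bounded; the
  sum over \<open>u\<close> is harmonic, with \<open>ln (R * 2 ^ t) <= 13 * t\<close>.\<close>

lemma sum_W_inverse_le: "(\<Sum>(u, v)\<in>W i i'. 1 / (real u * real v)) \<le> 56 * t"
proof -
  define V where "V u = {v \<in> {1..R * 2 ^ t}. N i * v < 2 * N i' * u \<and> N i' * u < 2 * N i * v}" for u
  have W: "W i i' = (SIGMA u:{1..R * 2 ^ t}. V u)" by (auto simp: W_def V_def)
  have V: "(\<Sum>v\<in>V u. 1 / real v) \<le> 4" if u: "u > 0" for u
  proof -
    define y where "y = real (N i') * u / N i"
    have y: "y > 0" using u N_pos by (simp add: y_def)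
    have v: "real v \<le> 2 * y" "1 / real v \<le> 2 / y" if "v \<in> V u" for v
    proof -
      have "real (N i * v) < real (2 * N i' * u)" "real (N i' * u) < real (2 * N i * v)"
        using that unfolding V_def by (simp_all only: of_nat_less_iff mem_Collect_eq)
      then have "real (N i) * v < 2 * real (N i') * u" "real (N i') * u < 2 * real (N i) * v" by simp_all
      then have "v < 2 * y" "y < 2 * v" using N_pos[of i] by (simp_all add: y_def field_simps)
      moreover have "v > 0" using that by (auto simp: V_def)
      ultimately show "real v \<le> 2 * y" "1 / real v \<le> 2 / y" using y by (simp_all add: field_simps)
    qed
    have "V u \<subseteq> {1..nat \<lfloor>2 * y\<rfloor>}"
    proof
      fix x assume x: "x \<in> V u"
      then show "x \<in> {1..nat \<lfloor>2 * y\<rfloor>}" using v(1)[OF x] by (auto simp: V_def le_nat_floor)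
    qed
    then have "card (V u) \<le> nat \<lfloor>2 * y\<rfloor>" using card_mono[of "{1..nat \<lfloor>2 * y\<rfloor>}" "V u"] by simp
    moreover have "real (nat \<lfloor>2 * y\<rfloor>) \<le> 2 * y" using y by simp
    ultimately have cV: "real (card (V u)) \<le> 2 * y" by linarith
    have "(\<Sum>v\<in>V u. 1 / real v) \<le> real (card (V u)) * (2 / y)"
      using v(2) by (intro sum_bounded_above) auto
    also have "\<dots> \<le> (2 * y) * (2 / y)" using cV y by (intro mult_right_mono) auto
    finally show ?thesis using y by simp
  qed
  have "(\<Sum>(u, v)\<in>W i i'. 1 / (real u * real v)) = (\<Sum>u\<in>{1..R * 2 ^ t}. \<Sum>v\<in>V u. 1 / (real u * real v))"
    unfolding W by (rule sum.Sigma[symmetric]) (auto simp: V_def)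
  also have "\<dots> = (\<Sum>u\<in>{1..R * 2 ^ t}. 1 / real u * (\<Sum>v\<in>V u. 1 / real v))"
    by (simp add: sum_distrib_left)
  also have "\<dots> \<le> (\<Sum>u\<in>{1..R * 2 ^ t}. 1 / real u * 4)"
    by (intro sum_mono mult_left_mono V) auto
  also have "\<dots> = 4 * (\<Sum>u\<in>{1..R * 2 ^ t}. 1 / real u)" by (simp add: sum_distrib_left)
  also have "\<dots> \<le> 4 * harm (R * 2 ^ t)" by (intro mult_left_mono sum_inverse_le_harm) auto
  also have "\<dots> \<le> 4 * (1 + 13 * real t)"
  proof -
    have "R * 2 ^ t = 2 ^ (12 * t + t)" by (simp only: R_def power_add)
    then have "ln (real (R * 2 ^ t)) = real (12 * t + t) * ln 2" by (simp add: ln_realpow)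
    also have "\<dots> \<le> real (12 * t + t) * 1" using ln_le_minus_one[of 2] by (intro mult_left_mono) auto
    finally show ?thesis using harm_le_ln[of "R * 2 ^ t"] R_pos by simp
  qed
  also have "\<dots> \<le> 56 * t" using t_ge by simp
  finally show ?thesis .
qed

text \<open>Here \<open>d\<close> runs through about \<open>N i / u >= Q\<close> integers, long
  enough for \<open>card_near_both_le\<close>. One factor \<open>N i / u\<close> comes from the
  count and one from the size of \<open>d\<close>; the ratio condition in \<open>W\<close> trades
  one of them for \<open>2 * N i' / v\<close>.\<close>

lemma sum_common_factor_le:
  assumes j: "j < t" "j' < t" and uv: "(u, v) \<in> W i i'" "coprime u v"
  shows "(\<Sum>d\<in>{d. d * u \<in> B i j \<and> d * v \<in> B i' j'}. real d)
    \<le> real (N i) * N i' * (4608 * \<delta> j * \<delta> j' * (1 / (real u * v)) + 384 * (min (\<delta> j / u) (\<delta> j' / v) / (real u * v)))"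
proof -
  define D where "D = {d. d * u \<in> B i j \<and> d * v \<in> B i' j'}"
  define x where "x = N i div u"
  define Y where "Y = x + 2"
  define E where "E = 288 * \<delta> j * \<delta> j' + 24 * min (\<delta> j / u) (\<delta> j' / v)"
  have pos: "u > 0" "v > 0" using uv by (auto simp: W_def)
  have uQ: "real w \<le> \<delta> k * Q" if "w \<le> R * 2 ^ t" "k < t" for w k
  proof -
    have "w * q \<le> R * 2 ^ t * q" using that by simp
    also have "\<dots> \<le> Q" by (rule q_R_le)
    finally have "real (w * q) \<le> Q" by (rule of_nat_mono)
    then have "real w \<le> (1 / q) * Q" using q_pos by (simp add: field_simps)
    also have "\<dots> \<le> \<delta> k * Q" using \<delta>_ge that by (intro mult_right_mono) auto
    finally show ?thesis .
  qed
  have u_le: "real u \<le> \<delta> j * Q" and v_le: "real v \<le> \<delta> j' * Q" using uv j by (auto simp: W_def intro!: uQ)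
  have uQ': "u \<le> Q"
  proof -
    have "real u \<le> \<delta> j * Q" by (rule u_le)
    also have "\<dots> \<le> 1 * real Q" using \<delta>_le[of j] by (intro mult_right_mono) auto
    finally show ?thesis by simp
  qed
  have "Q * u \<le> Q * Q" using uQ' by simp
  also have "\<dots> \<le> N i" using Q2_le_N[of i] by (simp add: power2_eq_square)
  finally have Qx: "Q \<le> x" unfolding x_def using pos by (simp add: less_eq_div_iff_mult_less_eq)
  have Nx: "N i = u * x + N i mod u" "N i mod u < u" using pos by (simp_all add: x_def)
  have "2 \<le> x"
  proof -
    have "2 ^ 1 \<le> (2::nat) ^ (20 * t)" using t_ge by (intro power_increasing) auto
    then show ?thesis using Q_ge Qx by simp
  qed
  then have "real Y \<le> 2 * real x" by (simp add: Y_def)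
  also have "\<dots> \<le> 2 * (N i / u)" unfolding x_def by (intro mult_left_mono of_nat_div_le_of_nat) auto
  finally have Y: "real Y \<le> 2 * (N i / u)" .
  have E0: "E \<ge> 0" using \<delta>_pos[of j] \<delta>_pos[of j'] by (simp add: E_def)
  let ?P = "\<lambda>d. near (\<delta> j) (of_int d * (real u * \<alpha>) + - \<gamma>) \<and> near (\<delta> j') (of_int d * (real v * \<alpha>) + - \<gamma>)"
  have dN: "x \<le> d" "d < x + Y" "?P (int d)" if d: "d \<in> D" for d
  proof -
    have "N i \<le> u * d" "u * d < 2 * N i" using d by (auto simp: B_def D_def mult.commute)
    moreover have "u * (2 * x + 2) = 2 * (u * x) + 2 * u" by (simp add: algebra_simps)
    ultimately have "u * x \<le> u * d" "u * d < u * (2 * x + 2)" using Nx by linarith+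
    then have "x \<le> d" "d < 2 * x + 2" using pos by (simp_all only: mult_le_cancel1 mult_less_cancel1)
    then show "x \<le> d" "d < x + Y" by (simp_all add: Y_def)
    show "?P (int d)" using d by (simp add: D_def B_def mult_ac)
  qed
  have "card D \<le> card {d \<in> {x..<x + Y}. ?P (int d)}" using dN by (intro card_mono) auto
  also have "\<dots> = card {d \<in> {int x..<int x + int Y}. ?P d}" by (rule card_filter_int)
  also have "real \<dots> \<le> 2 * real Y * E"
    unfolding E_def using pos uv Qx \<delta>_le[of j] \<delta>_le[of j'] u_le v_le
    by (intro card_near_both_le[OF Q_pos cop approx]) (auto simp: Y_def)
  also have "\<dots> \<le> 2 * (2 * (N i / u)) * E" using Y E0 by (intro mult_right_mono mult_left_mono) auto
  finally have cD: "real (card D) \<le> 4 * (N i / u) * E" by simp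
  have "(\<Sum>d\<in>D. real d) \<le> real (card D) * (2 * (N i / u))"
  proof (rule sum_bounded_above)
    fix d assume d: "d \<in> D"
    then have "d * u < 2 * N i" by (auto simp: B_def D_def)
    then have "real (d * u) \<le> real (2 * N i)" by (intro of_nat_mono) simp
    then show "real d \<le> 2 * (N i / u)" using pos by (simp add: field_simps)
  qed
  also have "\<dots> \<le> (4 * (N i / u) * E) * (2 * (N i / u))" using cD by (intro mult_right_mono) auto
  also have "\<dots> = 8 * E * (real (N i) / u) * (real (N i) / u)" by simp
  also have "\<dots> \<le> 8 * E * (real (N i) / u) * (2 * (real (N i') / v))"
  proof (rule mult_left_mono)
    have "real (N i * v) \<le> real (2 * N i' * u)" using uv(1) by (intro of_nat_mono) (auto simp: W_def)
    then show "real (N i) / u \<le> 2 * (real (N i') / v)" using pos by (simp add: field_simps)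
  qed (use E0 in auto)
  also have "\<dots> = real (N i) * N i' * (4608 * \<delta> j * \<delta> j' * (1 / (real u * v)) + 384 * (min (\<delta> j / u) (\<delta> j' / v) / (real u * v)))"
    by (simp add: E_def distrib_left distrib_right divide_inverse mult_ac)
  finally show ?thesis unfolding D_def .
qed

text \<open>With \<open>g = gcd n m\<close>, write \<open>(n, m) = (g * u, g * v)\<close>. From
  \<open>g > Q\<^sup>2 / R\<close> and the sizes of \<open>n\<close> and \<open>m\<close> the
  cofactors are at most \<open>R * 2 ^ t\<close>, and \<open>u / v = n / m\<close> is within a
  factor 2 of \<open>N i / N i'\<close>, so \<open>(u, v)\<close> lies in \<open>W\<close>. The sum
  with \<open>min\<close> is estimated only after summation over the scales.\<close>

lemma sum_large_gcd_le:
  assumes i: "i < t" "i' < t" and j: "j < t" "j' < t"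
  shows "(\<Sum>(n, m)\<in>{(n, m) \<in> B i j \<times> B i' j'. Q\<^sup>2 < gcd n m * R}. real (gcd n m))
    \<le> real (N i) * N i' * (260000 * t * \<delta> j * \<delta> j' + 384 * (\<Sum>(u, v)\<in>W i i'. min (\<delta> j / u) (\<delta> j' / v) / (real u * v)))"
proof -
  define D where "D = (\<lambda>(u, v). {d. d * u \<in> B i j \<and> d * v \<in> B i' j'})"
  define W' where "W' = {(u, v) \<in> W i i'. coprime u v}"
  have sub: "W' \<subseteq> W i i'" by (auto simp: W'_def)
  have finW': "finite W'" by (rule finite_subset[OF sub]) simp
  have finD: "finite (D uv)" if "uv \<in> W'" for uv
  proof -
    obtain u v where uv: "uv = (u, v)" by force
    have "u > 0" using that by (auto simp: uv W'_def W_def)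
    then have "D uv \<subseteq> {..2 * N i}"
      unfolding D_def uv B_def by auto (metis le_trans less_imp_le_nat mult.right_neutral mult_le_mono2 Suc_leI One_nat_def)
    then show ?thesis by (rule finite_subset) simp
  qed
  have finZ: "finite {(n, m) \<in> B i j \<times> B i' j'. Q\<^sup>2 < gcd n m * R}"
    by (rule finite_subset[of _ "B i j \<times> B i' j'"]) auto
  have small: "u \<le> R * 2 ^ t" if "g * u < 2 * N k" "Q\<^sup>2 < g * R" "k < t" for g u k
  proof -
    have "Q\<^sup>2 * u \<le> g * R * u" using that by simp
    also have "\<dots> = (g * u) * R" by simp
    also have "\<dots> < 2 * N k * R" using that R_pos by simp
    also have "\<dots> = Q\<^sup>2 * (2 ^ Suc k * R)" by (simp add: N_def)
    finally have "u < 2 ^ Suc k * R" by (simp only: mult_less_cancel1)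
    also have "\<dots> \<le> 2 ^ t * R" using that(3) by (intro mult_le_mono1 power_increasing) auto
    finally show ?thesis by (simp add: mult.commute)
  qed
  have "(\<Sum>(n, m)\<in>{(n, m) \<in> B i j \<times> B i' j'. Q\<^sup>2 < gcd n m * R}. real (gcd n m))
      \<le> (\<Sum>(uv, d)\<in>Sigma W' D. real d)"
  proof (rule sum_le_included[where i = "\<lambda>((u, v), d). (d * u, d * v)"])
    show "\<forall>x\<in>{(n, m) \<in> B i j \<times> B i' j'. Q\<^sup>2 < gcd n m * R}.
       \<exists>y\<in>Sigma W' D. (case y of (uv, d) \<Rightarrow> (case uv of (u, v) \<Rightarrow> \<lambda>d. (d * u, d * v)) d) = x
         \<and> (case x of (n, m) \<Rightarrow> real (gcd n m)) \<le> (case y of (uv, d) \<Rightarrow> real d)"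
    proof (clarify, goal_cases)
      case (1 n m)
      have n: "N i \<le> n" "n < 2 * N i" "N i' \<le> m" "m < 2 * N i'" using 1 by (auto simp: B_def)
      define g where "g = gcd n m"
      have n0: "n > 0" "m > 0" using n N_pos[of i] N_pos[of i'] by auto
      obtain u v where u: "n = g * u" and v: "m = g * v" and co: "coprime u v"
        using n0 by (metis g_def gcd_coprime_exists gcd_nat.eq_neutr_iff mult.commute not_gr_zero)
      have pos: "g > 0" "u > 0" "v > 0" using n0 u v by auto
      have "Q\<^sup>2 < g * R" using 1 by (simp add: g_def)
      then have "u \<le> R * 2 ^ t" "v \<le> R * 2 ^ t"
        using n i small[of g u i] small[of g v i'] unfolding u v by auto
      moreover have "N i * v < 2 * N i' * u"
      proof -
        have "N i * v \<le> (g * u) * v" using n(1) u by simp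
        also have "\<dots> = m * u" by (simp add: v)
        also have "\<dots> < 2 * N i' * u" using n(4) pos by simp
        finally show ?thesis .
      qed
      moreover have "N i' * u < 2 * N i * v"
      proof -
        have "N i' * u \<le> (g * v) * u" using n(3) v by simp
        also have "\<dots> = n * v" by (simp add: u)
        also have "\<dots> < 2 * N i * v" using n(2) pos by simp
        finally show ?thesis .
      qed
      ultimately have "(u, v) \<in> W'" using pos co by (auto simp: W'_def W_def)
      moreover have "g \<in> D (u, v)" using 1 u v by (auto simp: D_def)
      moreover have "(g * u, g * v) = (n, m)" using u v by simp
      moreover have "real (gcd n m) \<le> real g" by (simp add: g_def)
      ultimately show ?case by (intro bexI[of _ "((u, v), g)"]) (simp_all only: prod.case SigmaI simp_thms)
    qed
  qed (use finZ finW' finD in \<open>auto intro!: finite_SigmaI\<close>)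
  also have "\<dots> = (\<Sum>uv\<in>W'. \<Sum>d\<in>D uv. real d)"
    using finW' finD by (intro sum.Sigma[symmetric]) auto
  also have "\<dots> \<le> (\<Sum>(u, v)\<in>W'. real (N i) * N i' * (4608 * \<delta> j * \<delta> j' * (1 / (real u * v)) + 384 * (min (\<delta> j / u) (\<delta> j' / v) / (real u * v))))"
  proof (rule sum_mono)
    fix uv assume "uv \<in> W'"
    then obtain u v where uv: "uv = (u, v)" "(u, v) \<in> W i i'" "coprime u v" by (auto simp: W'_def)
    show "(\<Sum>d\<in>D uv. real d) \<le> (case uv of (u, v) \<Rightarrow> real (N i) * N i' * (4608 * \<delta> j * \<delta> j' * (1 / (real u * v)) + 384 * (min (\<delta> j / u) (\<delta> j' / v) / (real u * v))))"
      using sum_common_factor_le[OF j uv(2,3)] by (simp add: uv(1) D_def)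
  qed
  also have "\<dots> \<le> (\<Sum>(u, v)\<in>W i i'. real (N i) * N i' * (4608 * \<delta> j * \<delta> j' * (1 / (real u * v)) + 384 * (min (\<delta> j / u) (\<delta> j' / v) / (real u * v))))"
  proof (rule sum_mono2[OF _ sub])
    have "0 \<le> min (\<delta> j / real u) (\<delta> j' / real v)" for u v :: nat using \<delta>_pos[of j] \<delta>_pos[of j'] by simp
    then have "0 \<le> real (N i) * N i' * (4608 * \<delta> j * \<delta> j' * (1 / (real u * v)) + 384 * (min (\<delta> j / u) (\<delta> j' / v) / (real u * v)))" for u v :: nat
      using \<delta>_pos[of j] \<delta>_pos[of j'] by (intro mult_nonneg_nonneg add_nonneg_nonneg divide_nonneg_nonneg) (simp_all add: less_imp_le)
    then show "0 \<le> (case uv of (u, v) \<Rightarrow> real (N i) * N i' * (4608 * \<delta> j * \<delta> j' * (1 / (real u * v)) + 384 * (min (\<delta> j / u) (\<delta> j' / v) / (real u * v))))" for uv :: "nat \<times> nat"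
      by (simp only: case_prod_unfold)
  qed simp
  also have "\<dots> = real (N i) * N i' * (4608 * \<delta> j * \<delta> j' * (\<Sum>(u, v)\<in>W i i'. 1 / (real u * v))
      + 384 * (\<Sum>(u, v)\<in>W i i'. min (\<delta> j / u) (\<delta> j' / v) / (real u * v)))"
    by (simp only: case_prod_unfold sum.distrib sum_distrib_left distrib_left)
  also have "\<dots> \<le> real (N i) * N i' * (4608 * \<delta> j * \<delta> j' * (56 * t)
      + 384 * (\<Sum>(u, v)\<in>W i i'. min (\<delta> j / u) (\<delta> j' / v) / (real u * v)))"
    using sum_W_inverse_le[of i i'] \<delta>_pos[of j] \<delta>_pos[of j'] by (intro mult_left_mono add_right_mono) auto
  also have "\<dots> \<le> real (N i) * N i' * (260000 * t * \<delta> j * \<delta> j' + 384 * (\<Sum>(u, v)\<in>W i i'. min (\<delta> j / u) (\<delta> j' / v) / (real u * v)))"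
    using \<delta>_pos[of j] \<delta>_pos[of j'] by (intro mult_left_mono add_right_mono) (auto simp: mult_ac)
  finally show ?thesis .
qed

lemma sum_gcd_le:
  assumes i: "i < t" "i' < t" and j: "j < t" "j' < t"
  shows "(\<Sum>n\<in>B i j. \<Sum>m\<in>B i' j'. real (gcd n m))
    \<le> real (N i) * N i' * (300000 * t * \<delta> j * \<delta> j' + 384 * (\<Sum>(u, v)\<in>W i i'. min (\<delta> j / u) (\<delta> j' / v) / (real u * v)))"
proof -
  let ?S = "{(n, m) \<in> B i j \<times> B i' j'. gcd n m * R \<le> Q\<^sup>2}"
  let ?L = "{(n, m) \<in> B i j \<times> B i' j'. Q\<^sup>2 < gcd n m * R}"
  have fin: "finite ?S" "finite ?L" by (rule finite_subset[of _ "B i j \<times> B i' j'"]; auto)+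
  have un: "B i j \<times> B i' j' = ?S \<union> ?L" by auto
  have "(\<Sum>n\<in>B i j. \<Sum>m\<in>B i' j'. real (gcd n m)) = (\<Sum>(n, m)\<in>B i j \<times> B i' j'. real (gcd n m))"
    by (rule sum.cartesian_product)
  also have "\<dots> = (\<Sum>(n, m)\<in>?S. real (gcd n m)) + (\<Sum>(n, m)\<in>?L. real (gcd n m))"
    by (subst un, rule sum.union_disjoint[OF fin]) auto
  also have "\<dots> \<le> 40000 * t * N i * N i' * \<delta> j * \<delta> j' + real (N i) * N i' * (260000 * t * \<delta> j * \<delta> j' + 384 * (\<Sum>(u, v)\<in>W i i'. min (\<delta> j / u) (\<delta> j' / v) / (real u * v)))"
    by (intro add_mono sum_small_gcd_le sum_large_gcd_le i j)
  also have "\<dots> = real (N i) * N i' * (300000 * t * \<delta> j * \<delta> j' + 384 * (\<Sum>(u, v)\<in>W i i'. min (\<delta> j / u) (\<delta> j' / v) / (real u * v)))"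
    by (simp add: algebra_simps)
  finally show ?thesis .
qed

section \<open>Weighted summation over all scales\<close>

text \<open>\<open>e j\<close> is the square root of \<open>\<delta> j\<close>, and \<open>\<mu> i j i' j'\<close> is up to the factor \<open>\<epsilon> / t\<^sup>2\<close> a bound for
  the length of an overlap of two intervals occurring in the sets for \<open>n \<in> B i j\<close> and \<open>m \<in> B i' j'\<close>.\<close>

definition e :: "nat \<Rightarrow> real" where "e j = 1 / 2 ^ (j + 2)"

lemma e_pos: "e j > 0" by (simp add: e_def)

lemma \<delta>_eq: "\<delta> j = e j ^ 2"
proof -
  have "(2::real) ^ (j + 2) * 2 ^ (j + 2) = 4 ^ (j + 2)" by (simp only: flip: power_mult_distrib) simp
  then show ?thesis by (simp add: \<delta>_def e_def power2_eq_square)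
qed

lemma sum_e_le: "(\<Sum>j<n. e j) \<le> 1 / 2"
proof -
  have "(\<Sum>j<n. e j) = 1 / 2 - 1 / 2 ^ (n + 1)" by (induction n) (simp_all add: e_def field_simps)
  then show ?thesis by simp
qed

definition \<mu> :: "nat \<Rightarrow> nat \<Rightarrow> nat \<Rightarrow> nat \<Rightarrow> real" where
  "\<mu> i j i' j' = min (1 / (real (N i) ^ 2 * \<delta> j)) (1 / (real (N i') ^ 2 * \<delta> j'))"

text \<open>After \<open>e j * e j'\<close> is extracted, the two entries of the minimum are
  \<open>s * 2 ^ i'\<close> and its reciprocal, so the sum over \<open>i'\<close> is a two-sided
  geometric series bounded uniformly in \<open>s\<close>. The extracted factor is summable over
  \<open>j\<close> and \<open>j'\<close>.\<close>

lemma sum_mu_main_le: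
  "(\<Sum>i'<t. \<mu> i j i' j' * (real (N i) * N i' * (\<delta> j * \<delta> j'))) \<le> 6 * (e j * e j')"
proof -
  define s where "s = e j' / (e j * 2 ^ i)"
  have s: "s > 0" using e_pos[of j] e_pos[of j'] by (simp add: s_def)
  have "\<mu> i j i' j' * (real (N i) * N i' * (\<delta> j * \<delta> j')) = e j * e j' * min (s * 2 ^ i') (1 / (s * 2 ^ i'))" for i'
  proof -
    have 1: "1 / (real (N i) ^ 2 * \<delta> j) * (real (N i) * N i' * (\<delta> j * \<delta> j')) = e j * e j' * (s * 2 ^ i')"
      using Q_pos e_pos[of j] e_pos[of j'] by (simp add: N_def \<delta>_eq s_def field_simps power2_eq_square)
    have 2: "1 / (real (N i') ^ 2 * \<delta> j') * (real (N i) * N i' * (\<delta> j * \<delta> j')) = e j * e j' * (1 / (s * 2 ^ i'))"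
      using Q_pos e_pos[of j] e_pos[of j'] by (simp add: N_def \<delta>_eq s_def field_simps power2_eq_square)
    have "0 \<le> real (N i) * N i' * (\<delta> j * \<delta> j')" "0 \<le> e j * e j'"
      using \<delta>_pos[of j] \<delta>_pos[of j'] e_pos[of j] e_pos[of j'] by simp_all
    then show ?thesis unfolding \<mu>_def using 1 2
      by (simp add: min_mult_distrib_right min_mult_distrib_left)
  qed
  then have "(\<Sum>i'<t. \<mu> i j i' j' * (real (N i) * N i' * (\<delta> j * \<delta> j'))) = e j * e j' * (\<Sum>i'<t. min (s * 2 ^ i') (1 / (s * 2 ^ i')))"
    by (simp add: sum_distrib_left)
  also have "\<dots> \<le> e j * e j' * 6"
    using s e_pos[of j] e_pos[of j'] by (intro mult_left_mono sum_two_sided_geometric_le) auto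
  finally show ?thesis by simp
qed

text \<open>Division by \<open>e j * e j'\<close> turns the entries into \<open>s * 2 ^ j'\<close>
  and its reciprocal, up to the common factor \<open>1 / (sqrt u * sqrt v)\<close>. This extra decay
  makes the later sum over cofactors converge.\<close>

lemma sum_min_le:
  assumes "u > 0" "v > 0"
  shows "(\<Sum>j'<t. min (\<delta> j / real u) (\<delta> j' / real v) / (e j * e j')) \<le> 6 / (sqrt u * sqrt v)"
proof -
  define a b where "a = sqrt u" and "b = sqrt v"
  have ab: "a > 0" "b > 0" "real u = a ^ 2" "real v = b ^ 2" using assms by (simp_all add: a_def b_def)
  define s where "s = e j * 4 * b / a"
  have s: "s > 0" using ab e_pos[of j] by (simp add: s_def)
  have "min (\<delta> j / real u) (\<delta> j' / real v) / (e j * e j') = 1 / (a * b) * min (s * 2 ^ j') (1 / (s * 2 ^ j'))" for j'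
  proof -
    have e4: "e j' = 1 / (4 * 2 ^ j')" by (simp add: e_def)
    have 1: "\<delta> j / real u / (e j * e j') = 1 / (a * b) * (s * 2 ^ j')"
      using ab e_pos[of j] by (simp add: \<delta>_eq s_def e4 field_simps power2_eq_square)
    have 2: "\<delta> j' / real v / (e j * e j') = 1 / (a * b) * (1 / (s * 2 ^ j'))"
      using ab e_pos[of j] by (simp add: \<delta>_eq s_def e4 field_simps power2_eq_square)
    have "0 < e j * e j'" "0 \<le> 1 / (a * b)" using ab e_pos[of j] e_pos[of j'] by simp_all
    then show ?thesis using 1 2 by (simp only: min_divide_distrib_right min_mult_distrib_left less_imp_le if_True)
  qed
  then have "(\<Sum>j'<t. min (\<delta> j / real u) (\<delta> j' / real v) / (e j * e j')) = 1 / (a * b) * (\<Sum>j'<t. min (s * 2 ^ j') (1 / (s * 2 ^ j')))"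
    by (simp add: sum_distrib_left)
  also have "\<dots> \<le> 1 / (a * b) * 6"
    using s ab by (intro mult_left_mono sum_two_sided_geometric_le) auto
  finally show ?thesis by (simp add: a_def b_def)
qed

text \<open>The ratio condition forces \<open>2 ^ i'\<close> to agree with
  \<open>2 ^ i * v / u\<close> up to a factor 2. Each such \<open>i'\<close> contributes at least
  \<open>1 / 2\<close> to a two-sided geometric sum, which bounds their number.\<close>

lemma card_W_fibre_le:
  assumes "u > 0" "v > 0"
  shows "(\<Sum>i'<t. of_bool ((u, v) \<in> W i i')) \<le> (12 :: real)"
proof -
  define s where "s = real u / (2 ^ i * real v)"
  have s: "s > 0" using assms by (simp add: s_def)
  have "of_bool ((u, v) \<in> W i i') \<le> 2 * min (s * 2 ^ i') (1 / (s * 2 ^ i'))" for i'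
  proof (cases "(u, v) \<in> W i i'")
    case True
    then have "N i * v < 2 * N i' * u" "N i' * u < 2 * N i * v" by (auto simp: W_def)
    then have "Q\<^sup>2 * (2 ^ i * v) < Q\<^sup>2 * (2 * (2 ^ i' * u))" "Q\<^sup>2 * (2 ^ i' * u) < Q\<^sup>2 * (2 * (2 ^ i * v))"
      by (simp_all add: N_def mult_ac)
    then have "2 ^ i * v < 2 * (2 ^ i' * u)" "2 ^ i' * u < 2 * (2 ^ i * v)"
      by (simp_all only: mult_less_cancel1)
    then have "real (2 ^ i * v) < real (2 * (2 ^ i' * u))" "real (2 ^ i' * u) < real (2 * (2 ^ i * v))"
      by (simp_all only: of_nat_less_iff)
    then have *: "2 ^ i * real v < 2 * (2 ^ i' * real u)" "2 ^ i' * real u < 2 * (2 ^ i * real v)" by simp_all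
    have "1 \<le> 2 * (s * 2 ^ i')" "1 \<le> 2 * (1 / (s * 2 ^ i'))"
      using * assms by (simp_all add: s_def field_simps)
    then have "1 \<le> 2 * min (s * 2 ^ i') (1 / (s * 2 ^ i'))" unfolding min_def by presburger
    then show ?thesis using True by simp
  qed (use s in simp)
  then have "(\<Sum>i'<t. of_bool ((u, v) \<in> W i i')) \<le> (\<Sum>i'<t. 2 * min (s * 2 ^ i') (1 / (s * 2 ^ i')))"
    by (intro sum_mono)
  also have "\<dots> \<le> 2 * 6"
    unfolding sum_distrib_left[symmetric] by (intro mult_left_mono sum_two_sided_geometric_le s) auto
  finally show ?thesis by simp
qed

text \<open>Bounding \<open>\<mu>\<close> by the geometric mean cancels \<open>N i * N i'\<close>
  and leaves \<open>1 / (e j * e j')\<close>. The sum over \<open>j'\<close> gains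
  \<open>1 / (sqrt u * sqrt v)\<close>, the sum over \<open>j\<close> costs \<open>t\<close>, and
  each \<open>(u, v)\<close> occurs for boundedly many \<open>i'\<close>; what remains is a
  convergent double sum over \<open>u\<close> and \<open>v\<close>.\<close>

lemma sum_mu_W_le:
  "(\<Sum>i'<t. \<Sum>j<t. \<Sum>j'<t. \<mu> i j i' j' * (real (N i) * N i' * (\<Sum>(u, v)\<in>W i i'. min (\<delta> j / u) (\<delta> j' / v) / (real u * v))))
    \<le> 648 * t"
proof -
  let ?U = "{1..R * 2 ^ t}"
  define g where "g u v = 6 * real t / (real u * sqrt u * (real v * sqrt v))" for u v :: nat
  have "(\<Sum>j<t. \<Sum>j'<t. \<mu> i j i' j' * (real (N i) * N i' * (\<Sum>(u, v)\<in>W i i'. min (\<delta> j / u) (\<delta> j' / v) / (real u * v))))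
      \<le> (\<Sum>(u, v)\<in>W i i'. g u v)" for i'
  proof -
    let ?f = "\<lambda>j j' u v. min (\<delta> j / real u) (\<delta> j' / real v) / (real u * v)"
    have "(\<Sum>j<t. \<Sum>j'<t. \<mu> i j i' j' * (real (N i) * N i' * (\<Sum>(u, v)\<in>W i i'. ?f j j' u v)))
      \<le> (\<Sum>j<t. \<Sum>j'<t. \<Sum>(u, v)\<in>W i i'. 1 / (real u * v) * (min (\<delta> j / real u) (\<delta> j' / real v) / (e j * e j')))"
    proof (intro sum_mono)
      fix j j'
      have F: "0 \<le> (\<Sum>(u, v)\<in>W i i'. ?f j j' u v)"
        using \<delta>_pos[of j] \<delta>_pos[of j'] by (intro sum_nonneg) auto
      have "\<mu> i j i' j' \<le> 1 / ((N i * e j) * (N i' * e j'))"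
        using min_inverse_squares_le[of "N i * e j" "N i' * e j'"] N_pos e_pos
        by (simp add: \<mu>_def \<delta>_eq power_mult_distrib)
      then have "\<mu> i j i' j' * (real (N i) * N i' * (\<Sum>(u, v)\<in>W i i'. ?f j j' u v))
         \<le> 1 / ((N i * e j) * (N i' * e j')) * (real (N i) * N i' * (\<Sum>(u, v)\<in>W i i'. ?f j j' u v))"
        using F by (intro mult_right_mono) auto
      also have "\<dots> = 1 / (e j * e j') * (\<Sum>(u, v)\<in>W i i'. ?f j j' u v)"
        using N_pos[of i] N_pos[of i'] by (simp add: field_simps)
      also have "\<dots> = (\<Sum>(u, v)\<in>W i i'. 1 / (real u * v) * (min (\<delta> j / real u) (\<delta> j' / real v) / (e j * e j')))"
        unfolding sum_distrib_left by (intro sum.cong) (auto simp: mult_ac)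
      finally show "\<mu> i j i' j' * (real (N i) * N i' * (\<Sum>(u, v)\<in>W i i'. ?f j j' u v)) \<le> \<dots>" .
    qed
    also have "\<dots> = (\<Sum>(u, v)\<in>W i i'. 1 / (real u * v) * (\<Sum>j<t. \<Sum>j'<t. min (\<delta> j / real u) (\<delta> j' / real v) / (e j * e j')))"
      by (simp only: case_prod_unfold sum_distrib_left sum.swap[of _ "W i i'"])
    also have "\<dots> \<le> (\<Sum>(u, v)\<in>W i i'. g u v)"
    proof (rule sum_mono, clarify)
      fix u v assume "(u, v) \<in> W i i'"
      then have uv: "u > 0" "v > 0" by (auto simp: W_def)
      have "(\<Sum>j<t. \<Sum>j'<t. min (\<delta> j / real u) (\<delta> j' / real v) / (e j * e j')) \<le> (\<Sum>j<t. 6 / (sqrt u * sqrt v))"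
        using uv by (intro sum_mono sum_min_le)
      then have "1 / (real u * v) * (\<Sum>j<t. \<Sum>j'<t. min (\<delta> j / real u) (\<delta> j' / real v) / (e j * e j'))
        \<le> 1 / (real u * v) * (t * (6 / (sqrt u * sqrt v)))"
        by (intro mult_left_mono) auto
      also have "\<dots> = g u v" by (simp add: g_def mult_ac)
      finally show "1 / (real u * v) * (\<Sum>j<t. \<Sum>j'<t. min (\<delta> j / real u) (\<delta> j' / real v) / (e j * e j')) \<le> g u v" .
    qed
    finally show ?thesis .
  qed
  then have "(\<Sum>i'<t. \<Sum>j<t. \<Sum>j'<t. \<mu> i j i' j' * (real (N i) * N i' * (\<Sum>(u, v)\<in>W i i'. min (\<delta> j / u) (\<delta> j' / v) / (real u * v))))
      \<le> (\<Sum>i'<t. \<Sum>(u, v)\<in>W i i'. g u v)" by (intro sum_mono)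
  \<comment> \<open>\<open>of_bool\<close> extends the sum to a rectangle independent of
    \<open>i'\<close>, so that the order of summation can be exchanged.\<close>
  also have "\<dots> = (\<Sum>i'<t. \<Sum>(u, v)\<in>?U \<times> ?U. of_bool ((u, v) \<in> W i i') * g u v)"
    by (intro sum.cong[OF refl] sum.mono_neutral_cong_left) (auto simp: W_def)
  also have "\<dots> = (\<Sum>(u, v)\<in>?U \<times> ?U. (\<Sum>i'<t. of_bool ((u, v) \<in> W i i')) * g u v)"
    by (subst sum.swap) (simp only: case_prod_unfold sum_distrib_right)
  also have "\<dots> \<le> (\<Sum>(u, v)\<in>?U \<times> ?U. 12 * g u v)"
  proof (rule sum_mono, clarify)
    fix u v assume "u \<in> ?U" "v \<in> ?U"
    then have "u > 0" "v > 0" by auto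
    then show "(\<Sum>i'<t. of_bool ((u, v) \<in> W i i')) * g u v \<le> 12 * g u v"
      by (intro mult_right_mono card_W_fibre_le) (simp_all add: g_def)
  qed
  also have "\<dots> = (\<Sum>u\<in>?U. \<Sum>v\<in>?U. 72 * t * (1 / (real u * sqrt u) * (1 / (real v * sqrt v))))"
    unfolding sum.cartesian_product by (simp add: g_def)
  also have "\<dots> = 72 * t * (\<Sum>u\<in>?U. \<Sum>v\<in>?U. 1 / (real u * sqrt u) * (1 / (real v * sqrt v)))"
    by (simp only: sum_distrib_left)
  also have "\<dots> = 72 * t * ((\<Sum>u\<in>?U. 1 / (real u * sqrt u)) * (\<Sum>v\<in>?U. 1 / (real v * sqrt v)))"
    by (simp only: sum_product)
  also have "\<dots> \<le> real (72 * t) * (3 * 3)"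
    by (intro mult_mono sum_inverse_three_halves_le mult_left_mono sum_nonneg mult_nonneg_nonneg) auto
  finally show ?thesis by simp
qed

text \<open>Both contributions are quadratic in \<open>t\<close>: in the main one a factor
  \<open>t\<close> comes from \<open>sum_gcd_le\<close> and another from the free index
  \<open>i\<close>, in the other one from the free indices \<open>i\<close> and \<open>j\<close>.
  This matches the factor \<open>1 / t\<^sup>2\<close> in the radii.\<close>

lemma sum_mu_gcd_le:
  "(\<Sum>i<t. \<Sum>j<t. \<Sum>i'<t. \<Sum>j'<t. \<mu> i j i' j' * (\<Sum>n\<in>B i j. \<Sum>m\<in>B i' j'. real (gcd n m)))
    \<le> 1000000 * real t ^ 2"
proof -
  let ?X = "\<lambda>i j i' j'. \<mu> i j i' j' * (real (N i) * N i' * (\<delta> j * \<delta> j'))"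
  let ?Y = "\<lambda>i j i' j'. \<mu> i j i' j' * (real (N i) * N i' * (\<Sum>(u, v)\<in>W i i'. min (\<delta> j / u) (\<delta> j' / v) / (real u * v)))"
  have \<mu>0: "0 \<le> \<mu> i j i' j'" for i j i' j' using \<delta>_pos[of j] \<delta>_pos[of j'] by (simp add: \<mu>_def)
  have "(\<Sum>i<t. \<Sum>j<t. \<Sum>i'<t. \<Sum>j'<t. \<mu> i j i' j' * (\<Sum>n\<in>B i j. \<Sum>m\<in>B i' j'. real (gcd n m)))
      \<le> (\<Sum>i<t. \<Sum>j<t. \<Sum>i'<t. \<Sum>j'<t. 300000 * t * ?X i j i' j' + 384 * ?Y i j i' j')"
  proof (intro sum_mono)
    fix i j i' j' assume "i \<in> {..<t}" "j \<in> {..<t}" "i' \<in> {..<t}" "j' \<in> {..<t}"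
    then have "\<mu> i j i' j' * (\<Sum>n\<in>B i j. \<Sum>m\<in>B i' j'. real (gcd n m))
      \<le> \<mu> i j i' j' * (real (N i) * N i' * (300000 * t * \<delta> j * \<delta> j' + 384 * (\<Sum>(u, v)\<in>W i i'. min (\<delta> j / u) (\<delta> j' / v) / (real u * v))))"
      by (intro mult_left_mono sum_gcd_le \<mu>0) auto
    also have "\<dots> = 300000 * t * ?X i j i' j' + 384 * ?Y i j i' j'"
      by (simp add: algebra_simps)
    finally show "\<mu> i j i' j' * (\<Sum>n\<in>B i j. \<Sum>m\<in>B i' j'. real (gcd n m)) \<le> \<dots>" .
  qed
  also have "\<dots> = 300000 * t * (\<Sum>i<t. \<Sum>j<t. \<Sum>i'<t. \<Sum>j'<t. ?X i j i' j') + 384 * (\<Sum>i<t. \<Sum>j<t. \<Sum>i'<t. \<Sum>j'<t. ?Y i j i' j')"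
    by (simp only: sum.distrib sum_distrib_left)
  also have "\<dots> \<le> 300000 * t * (real t * (3 / 2)) + 384 * (real t * (648 * t))"
  proof (intro add_mono mult_left_mono)
    have "(\<Sum>j<t. \<Sum>i'<t. \<Sum>j'<t. ?X i j i' j') \<le> 3 / 2" for i
    proof -
      have "(\<Sum>j<t. \<Sum>i'<t. \<Sum>j'<t. ?X i j i' j') = (\<Sum>j<t. \<Sum>j'<t. \<Sum>i'<t. ?X i j i' j')"
        by (intro sum.cong[OF refl] sum.swap)
      also have "\<dots> \<le> (\<Sum>j<t. \<Sum>j'<t. 6 * (e j * e j'))" by (intro sum_mono sum_mu_main_le)
      also have "\<dots> = 6 * (\<Sum>j<t. \<Sum>j'<t. e j * e j')" by (simp only: sum_distrib_left)
      also have "\<dots> = 6 * ((\<Sum>j<t. e j) * (\<Sum>j<t. e j))" by (simp only: sum_product)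
      also have "\<dots> \<le> 6 * (1 / 2 * (1 / 2))"
        using e_pos by (intro mult_left_mono mult_mono sum_e_le sum_nonneg) (auto intro: less_imp_le)
      finally show ?thesis by simp
    qed
    then show "(\<Sum>i<t. \<Sum>j<t. \<Sum>i'<t. \<Sum>j'<t. ?X i j i' j') \<le> real t * (3 / 2)"
      using sum_bounded_above[of "{..<t}" "\<lambda>i. \<Sum>j<t. \<Sum>i'<t. \<Sum>j'<t. ?X i j i' j'" "3 / 2"] by simp
    have "(\<Sum>j<t. \<Sum>i'<t. \<Sum>j'<t. ?Y i j i' j') \<le> 648 * t" for i
      by (subst sum.swap) (rule sum_mu_W_le)
    then show "(\<Sum>i<t. \<Sum>j<t. \<Sum>i'<t. \<Sum>j'<t. ?Y i j i' j') \<le> real t * (648 * t)"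
      using sum_bounded_above[of "{..<t}" "\<lambda>i. \<Sum>j<t. \<Sum>i'<t. \<Sum>j'<t. ?Y i j i' j'" "648 * t"] by simp
  qed auto
  also have "\<dots> \<le> 1000000 * real t ^ 2" by (simp add: power2_eq_square)
  finally show ?thesis .
qed

end

section \<open>A zero-one criterion and the conclusion\<close>

text \<open>The inequality is integrated from \<open>y \<le> b / 2 + y\<^sup>2 / (2 * b)\<close>, where \<open>y\<close> counts the
  sets \<open>A k\<close> containing a point; it replaces the Cauchy--Schwarz inequality.\<close>

lemma sum_measure_Int_le:
  fixes A :: "'k \<Rightarrow> real set"
  assumes I: "finite I" and A: "\<And>k. k \<in> I \<Longrightarrow> A k \<in> sets borel"
    and E: "E \<in> sets borel" "E \<subseteq> {0..<1}" and b: "b > 0"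
  shows "(\<Sum>k\<in>I. measure lborel (E \<inter> A k))
    \<le> b / 2 * measure lborel E + (\<Sum>k\<in>I. \<Sum>l\<in>I. measure lborel ({0..<1} \<inter> A k \<inter> A l)) / (2 * b)"
proof -
  have fin: "emeasure lborel X < \<infinity>" if "X \<subseteq> {0..<1}" for X :: "real set"
    using emeasure_mono[OF that, of lborel] by (simp add: order_le_less_trans)
  have int: "integrable lborel (indicator X :: real \<Rightarrow> real)" if "X \<in> sets borel" "X \<subseteq> {0..<1}" for X
    using that fin by simp
  have EA: "integrable lborel (indicator (E \<inter> A k) :: real \<Rightarrow> real)" if "k \<in> I" for k
    by (rule int) (use A[OF that] E in auto)
  have AA: "integrable lborel (indicator ({0..<1} \<inter> A k \<inter> A l) :: real \<Rightarrow> real)" if "k \<in> I" "l \<in> I" for k l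
    by (rule int) (use A[OF that(1)] A[OF that(2)] in auto)
  define f :: "real \<Rightarrow> real" where "f x = (\<Sum>k\<in>I. indicator (E \<inter> A k) x)" for x
  define h :: "real \<Rightarrow> real" where "h x = b / 2 * indicator E x + (\<Sum>k\<in>I. \<Sum>l\<in>I. indicator ({0..<1} \<inter> A k \<inter> A l) x) / (2 * b)" for x
  have intf: "integrable lborel f" unfolding f_def by (intro Bochner_Integration.integrable_sum EA)
  have intS: "integrable lborel (\<lambda>x. \<Sum>k\<in>I. \<Sum>l\<in>I. indicator ({0..<1} \<inter> A k \<inter> A l) x :: real)"
    by (intro Bochner_Integration.integrable_sum AA)
  have intE: "integrable lborel (indicator E :: real \<Rightarrow> real)" by (rule int[OF E])
  have inth: "integrable lborel h" unfolding h_def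
    using intS intE by (intro Bochner_Integration.integrable_add integrable_mult_right integrable_divide) auto
  have le: "f x \<le> h x" for x
  proof (cases "x \<in> E")
    case True
    define y where "y = (\<Sum>k\<in>I. indicator (A k) x :: real)"
    have x: "x \<in> {0..<1}" using True E by auto
    have "f x = y" using True by (simp add: f_def y_def indicator_def)
    moreover have "h x = b / 2 + y\<^sup>2 / (2 * b)"
    proof -
      have "indicator ({0..<1} \<inter> A k \<inter> A l) x = indicator (A k) x * (indicator (A l) x :: real)" for k l
        using x by (simp add: indicator_def)
      then show ?thesis using True by (simp add: h_def y_def power2_eq_square sum_product)
    qed
    moreover have "y \<le> b / 2 + y\<^sup>2 / (2 * b)"
    proof -
      have "0 \<le> (y - b)\<^sup>2" by simp
      then have "2 * b * y \<le> b\<^sup>2 + y\<^sup>2" by (simp add: power2_eq_square algebra_simps)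
      then show ?thesis using b by (simp add: field_simps power2_eq_square)
    qed
    ultimately show ?thesis by simp
  next
    case False
    have "0 \<le> (\<Sum>k\<in>I. \<Sum>l\<in>I. indicator ({0..<1} \<inter> A k \<inter> A l) x :: real)" by (intro sum_nonneg) auto
    then show ?thesis using False b by (simp add: f_def h_def)
  qed
  have "(\<Sum>k\<in>I. measure lborel (E \<inter> A k)) = integral\<^sup>L lborel f"
    unfolding f_def using EA by simp
  also have "\<dots> \<le> integral\<^sup>L lborel h" by (rule integral_mono[OF intf inth le])
  also have "\<dots> = b / 2 * measure lborel E + (\<Sum>k\<in>I. \<Sum>l\<in>I. measure lborel ({0..<1} \<inter> A k \<inter> A l)) / (2 * b)"
  proof -
    have "integral\<^sup>L lborel (\<lambda>x. \<Sum>k\<in>I. \<Sum>l\<in>I. indicator ({0..<1} \<inter> A k \<inter> A l) x :: real)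
        = (\<Sum>k\<in>I. \<Sum>l\<in>I. measure lborel ({0..<1} \<inter> A k \<inter> A l))"
      using AA by (simp add: Bochner_Integration.integrable_sum)
    then show ?thesis unfolding h_def using intS intE by simp
  qed
  finally show ?thesis .
qed

section \<open>Dyadic approximation of closed sets and the criterion\<close>

text \<open>Half-open, so that the cells of one level partition the line.\<close>

definition dyadic_cell :: "nat \<Rightarrow> int \<Rightarrow> real set" where
  "dyadic_cell k l = {of_int l / 2 ^ k..<(of_int l + 1) / 2 ^ k}"

lemma mem_dyadic_cell_iff: "x \<in> dyadic_cell k l \<longleftrightarrow> \<lfloor>2 ^ k * x\<rfloor> = l"
  by (auto simp: dyadic_cell_def floor_eq_iff field_simps)

lemma measure_dyadic_cell [simp]: "measure lborel (dyadic_cell k l) = 1 / 2 ^ k"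
proof -
  have "real_of_int l / 2 ^ k \<le> (of_int l + 1) / 2 ^ k" by (simp add: divide_right_mono)
  then show ?thesis by (simp add: dyadic_cell_def diff_divide_distrib[symmetric])
qed

text \<open>The unions \<open>J k\<close> of the cells meeting \<open>K\<close> decrease with
  \<open>k\<close>. A point in all of them has distance less than \<open>1 / 2 ^ k\<close> from
  points of \<open>K\<close> for every \<open>k\<close>, hence lies in \<open>K\<close> by
  closedness; continuity from above then gives the limit.\<close>

lemma dyadic_neighbourhood_tendsto:
  fixes K :: "real set"
  assumes K: "closed K" "K \<subseteq> {0..<1}"
  defines "L \<equiv> \<lambda>k::nat. (\<lambda>y. \<lfloor>2 ^ k * y\<rfloor>) ` K"
  defines "J \<equiv> \<lambda>k::nat. \<Union>l\<in>L k. dyadic_cell k l"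
  shows "\<And>k. L k \<subseteq> {0..<2 ^ k}"
    and "\<And>k. K \<subseteq> J k"
    and "(\<lambda>k. measure lborel (J k)) \<longlonglongrightarrow> measure lborel K"
proof -
  show L: "L k \<subseteq> {0..<2 ^ k}" for k
  proof
    fix l assume "l \<in> L k"
    then obtain y where y: "y \<in> K" "l = \<lfloor>2 ^ k * y\<rfloor>" by (auto simp: L_def)
    have "0 \<le> y" "y < 1" using y K by auto
    then have "0 \<le> 2 ^ k * y" "2 ^ k * y < 2 ^ k" by simp_all
    then show "l \<in> {0..<2 ^ k}" using y by (simp add: floor_less_iff)
  qed
  have J: "x \<in> J k \<longleftrightarrow> (\<exists>y\<in>K. \<lfloor>2 ^ k * x\<rfloor> = \<lfloor>2 ^ k * y\<rfloor>)" for x k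
    by (auto simp: J_def L_def mem_dyadic_cell_iff)
  show KJ: "K \<subseteq> J k" for k using J by blast
  have "J (Suc k) \<subseteq> J k" for k
  proof
    fix x assume "x \<in> J (Suc k)"
    then obtain y where y: "y \<in> K" "\<lfloor>2 ^ Suc k * x\<rfloor> = \<lfloor>2 ^ Suc k * y\<rfloor>" using J by blast
    have "\<lfloor>2 ^ k * z\<rfloor> = \<lfloor>2 ^ Suc k * z\<rfloor> div 2" for z :: real
      using floor_divide_real_eq_div[of 2 "2 ^ Suc k * z"] by simp
    then show "x \<in> J k" using y J by metis
  qed
  then have dec: "decseq J" by (rule decseq_SucI)
  have "(\<Inter>k. J k) \<subseteq> K"
  proof
    fix x assume x: "x \<in> (\<Inter>k. J k)"
    have "x \<in> closure K"
      unfolding closure_approachable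
    proof (intro allI impI)
      fix r :: real assume "r > 0"
      then obtain k where k: "1 / 2 ^ k < r" using real_arch_pow_inv[of r "1 / 2"] by (auto simp: power_one_over)
      obtain y where y: "y \<in> K" "\<lfloor>2 ^ k * x\<rfloor> = \<lfloor>2 ^ k * y\<rfloor>" using x J by blast
      then have "\<bar>2 ^ k * y - 2 ^ k * x\<bar> < 1" by linarith
      then have "2 ^ k * \<bar>y - x\<bar> < 1" by (simp add: abs_mult flip: right_diff_distrib)
      then have "\<bar>y - x\<bar> < 1 / 2 ^ k" by (simp add: field_simps)
      then show "\<exists>y\<in>K. dist y x < r" using y k by (intro bexI[of _ y]) (auto simp: dist_real_def)
    qed
    then show "x \<in> K" using K(1) by simp
  qed
  then have eq: "(\<Inter>k. J k) = K" using KJ by auto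
  have "(\<lambda>k. measure lborel (J k)) \<longlonglongrightarrow> measure lborel (\<Inter>k. J k)"
  proof (rule Lim_measure_decseq[OF _ dec])
    have "J k \<in> fmeasurable lborel" for k
      unfolding J_def using finite_subset[OF L[of k]] by (intro fmeasurable.finite_UN) (auto simp: dyadic_cell_def)
    then show "range J \<subseteq> sets lborel" "emeasure lborel (J i) \<noteq> \<infinity>" for i
      by (auto simp: fmeasurable_def less_top)
  qed
  then show "(\<lambda>k. measure lborel (J k)) \<longlonglongrightarrow> measure lborel K" by (simp only: eq)
qed

text \<open>A positive-measure set avoiding all late families is approximated by dyadic cells: the
  lower bound on the cells contradicts \<open>sum_measure_Int_le\<close> on the thin remainder.\<close>

lemma null_sets_of_quasi_independent:
  fixes I :: "nat \<Rightarrow> 'k set" and A :: "nat \<Rightarrow> 'k \<Rightarrow> real set"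
  assumes fin: "\<And>m. finite (I m)" and meas: "\<And>m k. A m k \<in> sets borel"
    and c: "c > 0"
    and upper: "\<And>m. (\<Sum>k\<in>I m. \<Sum>l\<in>I m. measure lborel ({0..<1} \<inter> A m k \<inter> A m l)) \<le> C"
    and lower: "\<And>u v. u < v \<Longrightarrow> eventually (\<lambda>m. c * (v - u) \<le> (\<Sum>k\<in>I m. measure lborel ({u..<v} \<inter> A m k))) sequentially"
  shows "{x \<in> {0..<1}. eventually (\<lambda>m. \<forall>k\<in>I m. x \<notin> A m k) sequentially} \<in> null_sets lborel"
proof -
  define S where "S M = {0..<1} - (\<Union>m\<in>{M..}. \<Union>k\<in>I m. A m k)" for M
  have Sb: "S M \<in> sets borel" for M
    unfolding S_def using meas fin
    by (intro sets.Diff sets.countable_UN'' sets.finite_UN) auto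
  have "S M \<in> null_sets lborel" for M
  proof (rule ccontr)
    assume "S M \<notin> null_sets lborel"
    then have S0: "emeasure lborel (S M) \<noteq> 0" using Sb by (auto simp: null_sets_def)
    have Sfin: "emeasure lborel (S M) < \<infinity>"
      using emeasure_mono[of "S M" "{0..<1}" lborel] by (auto simp: S_def order_le_less_trans)
    define s where "s = measure lborel (S M)"
    have s1: "emeasure lborel (S M) = ennreal s"
      unfolding s_def using Sfin by (intro emeasure_eq_ennreal_measure) auto
    have "s \<noteq> 0" using S0 s1 by auto
    moreover have "s \<ge> 0" by (simp add: s_def)
    ultimately have s: "emeasure lborel (S M) = ennreal s" "s > 0" using s1 by simp_all
    \<comment> \<open>Inner regularity supplies the closed set required for dyadic approximation; a
      gap smaller than \<open>s\<close> leaves it positive measure.\<close>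
    obtain K where K: "closed K" "K \<subseteq> S M" "emeasure lebesgue (S M - K) < ennreal s"
    proof (rule sets_lebesgue_inner_closed[of "S M" s])
      show "S M \<in> sets lebesgue" using Sb by (simp add: sets_completionI_sets)
    qed (use s(2) in auto)
    have Kb: "K \<in> sets borel" using K(1) by simp
    have K01: "K \<subseteq> {0..<1}" using K(2) by (auto simp: S_def)
    define \<kappa> where "\<kappa> = measure lborel K"
    have \<kappa>: "\<kappa> > 0"
    proof (rule ccontr)
      assume "\<not> \<kappa> > 0"
      then have "\<kappa> = 0" using measure_nonneg[of lborel K] by (simp add: \<kappa>_def)
      moreover have "emeasure lborel K < \<infinity>" using emeasure_mono[OF K(2), of lborel] Sb Sfin by (auto intro: order_le_less_trans)
      ultimately have K0: "emeasure lborel K = 0"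
        by (simp add: \<kappa>_def emeasure_eq_ennreal_measure less_top)
      have "emeasure lborel (S M) \<le> emeasure lborel ((S M - K) \<union> K)" using Sb Kb by (intro emeasure_mono) auto
      also have "\<dots> \<le> emeasure lborel (S M - K) + emeasure lborel K" using Sb Kb by (intro emeasure_subadditive) auto
      also have "\<dots> = emeasure lebesgue (S M - K)" using K0 Sb Kb by (simp add: emeasure_completion)
      finally show False using K(3) s(1) by simp
    qed
    \<comment> \<open>The maximum with 1 keeps \<open>b\<close> positive, and \<open>b\<close> makes
      both terms of the final bound equal to \<open>c * \<kappa> / 4\<close>.\<close>
    define C' where "C' = max C 1"
    define b where "b = 2 * C' / (c * \<kappa>)"
    have b: "b > 0" using c \<kappa> by (simp add: b_def C'_def)
    define L where "L = (\<lambda>k::nat. (\<lambda>y. \<lfloor>2 ^ k * y\<rfloor>) ` K)"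
    define J where "J = (\<lambda>k::nat. \<Union>l\<in>L k. dyadic_cell k l)"
    have dy: "L k \<subseteq> {0..<2 ^ k}" "K \<subseteq> J k" "(\<lambda>k. measure lborel (J k)) \<longlonglongrightarrow> \<kappa>" for k
      using dyadic_neighbourhood_tendsto[OF K(1) K01] unfolding L_def J_def \<kappa>_def by blast+
    have "eventually (\<lambda>k. measure lborel (J k) < \<kappa> + c * \<kappa> / (2 * b)) sequentially"
      using b c \<kappa> by (intro order_tendstoD(2)[OF dy(3)]) simp_all
    then obtain k where k: "measure lborel (J k) < \<kappa> + c * \<kappa> / (2 * b)"
      by (auto simp: eventually_sequentially)
    have finL: "finite (L k)" using finite_subset[OF dy(1)[of k]] by simp
    have cellm: "dyadic_cell k l \<in> fmeasurable lborel" for l by (simp add: dyadic_cell_def)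
    have Jf: "J k \<in> fmeasurable lborel" unfolding J_def using finL cellm by (intro fmeasurable.finite_UN) auto
    then have Jb: "J k \<in> sets borel" by (simp add: fmeasurable_def)
    have J01: "J k \<subseteq> {0..<1}"
    proof
      fix x assume "x \<in> J k"
      then obtain l where l: "l \<in> L k" "of_int l / 2 ^ k \<le> x" "x < (of_int l + 1) / 2 ^ k" by (auto simp: J_def dyadic_cell_def)
      have "0 \<le> l" "l + 1 \<le> 2 ^ k" using dy(1)[of k] l(1) by auto
      then have "real_of_int (l + 1) \<le> of_int (2 ^ k)" by (simp only: of_int_le_iff)
      then have "(real_of_int l + 1) / 2 ^ k \<le> 1" by (simp add: field_simps)
      moreover have "0 \<le> real_of_int l / 2 ^ k" using \<open>0 \<le> l\<close> by simp
      ultimately have "0 \<le> x \<and> x < 1" using l(2,3) by linarith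
      then show "x \<in> {0..<1}" by simp
    qed
    have disj: "dyadic_cell k l \<inter> dyadic_cell k l' = {}" if "l \<noteq> l'" for l l'
      using that by (auto simp: mem_dyadic_cell_iff)
    have mJ: "measure lborel (J k \<inter> X) = (\<Sum>l\<in>L k. measure lborel (dyadic_cell k l \<inter> X))" if "X \<in> sets borel" for X
    proof -
      have "J k \<inter> X = (\<Union>l\<in>L k. dyadic_cell k l \<inter> X)" by (auto simp: J_def)
      moreover have fm: "dyadic_cell k l \<inter> X \<in> fmeasurable lborel" for l
        using cellm that by (intro fmeasurable_Int_fmeasurable) auto
      have "measure lborel (\<Union>l\<in>L k. dyadic_cell k l \<inter> X) = (\<Sum>l\<in>L k. measure lborel (dyadic_cell k l \<inter> X))"
      proof (rule measure_finite_Union[OF finL])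
        show "(\<lambda>l. dyadic_cell k l \<inter> X) ` L k \<subseteq> sets lborel" using fmeasurableD[OF fm] by blast
        show "disjoint_family_on (\<lambda>l. dyadic_cell k l \<inter> X) (L k)"
          unfolding disjoint_family_on_def using disj by blast
        show "emeasure lborel (dyadic_cell k l \<inter> X) \<noteq> \<infinity>" for l
          using fmeasurableD2[OF fm] by simp
      qed
      ultimately show ?thesis by simp
    qed
    have "eventually (\<lambda>m. \<forall>l\<in>L k. c * (1 / 2 ^ k) \<le> (\<Sum>i\<in>I m. measure lborel (dyadic_cell k l \<inter> A m i))) sequentially"
    proof (rule eventually_ball_finite[OF finL], rule ballI)
      fix l
      have "real_of_int l / 2 ^ k < (of_int l + 1) / 2 ^ k" by (simp add: divide_strict_right_mono)
      from lower[OF this] show "eventually (\<lambda>m. c * (1 / 2 ^ k) \<le> (\<Sum>i\<in>I m. measure lborel (dyadic_cell k l \<inter> A m i))) sequentially"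
        by (simp add: dyadic_cell_def diff_divide_distrib[symmetric])
    qed
    then have "eventually (\<lambda>m. M \<le> m \<and> (\<forall>l\<in>L k. c * (1 / 2 ^ k) \<le> (\<Sum>i\<in>I m. measure lborel (dyadic_cell k l \<inter> A m i)))) sequentially"
      by (intro eventually_conj eventually_ge_at_top)
    then obtain m where m: "M \<le> m" "\<And>l. l \<in> L k \<Longrightarrow> c * (1 / 2 ^ k) \<le> (\<Sum>i\<in>I m. measure lborel (dyadic_cell k l \<inter> A m i))"
      by (auto simp: eventually_sequentially)
    have "c * \<kappa> \<le> c * measure lborel (J k)"
      unfolding \<kappa>_def using c dy(2)[of k] Kb Jf by (intro mult_left_mono measure_mono_fmeasurable) auto
    also have "\<dots> = (\<Sum>l\<in>L k. c * (1 / 2 ^ k))"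
      using mJ[of UNIV] by simp
    also have "\<dots> \<le> (\<Sum>l\<in>L k. \<Sum>i\<in>I m. measure lborel (dyadic_cell k l \<inter> A m i))" by (intro sum_mono m(2))
    also have "\<dots> = (\<Sum>i\<in>I m. measure lborel (J k \<inter> A m i))"
      using meas by (subst sum.swap) (simp add: mJ)
    \<comment> \<open>Since \<open>m >= M\<close>, the sets of the family avoid \<open>K\<close>, so
      all their mass in \<open>J k\<close> lies in the thin set \<open>J k - K\<close>.\<close>
    also have "\<dots> = (\<Sum>i\<in>I m. measure lborel ((J k - K) \<inter> A m i))"
    proof (rule sum.cong[OF refl])
      fix i assume "i \<in> I m"
      then have "K \<inter> A m i = {}" using K(2) m(1) by (auto simp: S_def)
      then have "J k \<inter> A m i = (J k - K) \<inter> A m i" by auto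
      then show "measure lborel (J k \<inter> A m i) = measure lborel ((J k - K) \<inter> A m i)" by simp
    qed
    also have "\<dots> \<le> b / 2 * measure lborel (J k - K) + (\<Sum>i\<in>I m. \<Sum>l\<in>I m. measure lborel ({0..<1} \<inter> A m i \<inter> A m l)) / (2 * b)"
      using fin meas Jb Kb J01 b by (intro sum_measure_Int_le) auto
    also have "\<dots> \<le> b / 2 * (c * \<kappa> / (2 * b)) + C' / (2 * b)"
    proof (intro add_mono mult_left_mono divide_right_mono)
      have "measure lborel (J k - K) = measure lborel (J k) - measure lborel K"
        using Jf Kb dy(2)[of k] by (intro measure_Diff) (auto simp: fmeasurable_def)
      then show "measure lborel (J k - K) \<le> c * \<kappa> / (2 * b)" using k by (simp add: \<kappa>_def)
      show "(\<Sum>i\<in>I m. \<Sum>l\<in>I m. measure lborel ({0..<1} \<inter> A m i \<inter> A m l)) \<le> C'"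
        using upper[of m] by (simp add: C'_def)
    qed (use b in auto)
    also have "\<dots> = c * \<kappa> / 4 + c * \<kappa> / 4"
    proof -
      have "C' > 0" by (simp add: C'_def)
      then show ?thesis using c \<kappa> b by (simp add: b_def)
    qed
    also have "\<dots> < c * \<kappa>" using c \<kappa> by simp
    finally show False by simp
  qed
  then have "(\<Union>M. S M) \<in> null_sets lborel" by (intro null_sets_UN) auto
  moreover have "{x \<in> {0..<1}. eventually (\<lambda>m. \<forall>k\<in>I m. x \<notin> A m k) sequentially} = (\<Union>M. S M)"
  proof -
    have "S M = {x \<in> {0..<1}. \<forall>m\<ge>M. \<forall>k\<in>I m. x \<notin> A m k}" for M by (auto simp: S_def)
    then show ?thesis by (auto simp: eventually_sequentially)
  qed
  ultimately show ?thesis by simp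
qed

context approx_block
begin

section \<open>First and second moments of the hits\<close>

text \<open>The radius is chosen so that all \<open>t\<^sup>2\<close> cells contribute equally, about \<open>\<epsilon> / t\<^sup>2\<close> each, to
  the expected number of hits.\<close>

definition \<psi> :: "real \<Rightarrow> nat \<Rightarrow> nat \<Rightarrow> real" where
  "\<psi> \<epsilon> i j = \<epsilon> / (real (N i) * \<delta> j * real t ^ 2)"

text \<open>An index carries its cell \<open>(i, j)\<close> besides \<open>n\<close>: for fixed
  \<open>i\<close> the sets \<open>B i j\<close> are nested, and the radius depends on the
  cell.\<close>

definition Idx :: "((nat \<times> nat) \<times> nat) set" where
  "Idx = (SIGMA ij:{..<t} \<times> {..<t}. B (fst ij) (snd ij))"

definition Hit :: "real \<Rightarrow> real \<Rightarrow> (nat \<times> nat) \<times> nat \<Rightarrow> real set" where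
  "Hit \<epsilon> c k = {x. near (\<psi> \<epsilon> (fst (fst k)) (snd (fst k))) (real (snd k) * x + c)}"

lemma finite_Idx: "finite Idx"
  unfolding Idx_def by (intro finite_SigmaI) auto

lemma Hit_borel: "Hit \<epsilon> c k \<in> sets borel"
  by (simp add: Hit_def borel_near)

lemma sum_Idx: "(\<Sum>k\<in>Idx. f k) = (\<Sum>i<t. \<Sum>j<t. \<Sum>n\<in>B i j. f ((i, j), n))"
proof -
  have "(\<Sum>k\<in>Idx. f k) = (\<Sum>ij\<in>{..<t} \<times> {..<t}. \<Sum>n\<in>B (fst ij) (snd ij). f (ij, n))"
    unfolding Idx_def by (subst sum.Sigma) auto
  also have "\<dots> = (\<Sum>i<t. \<Sum>j<t. \<Sum>n\<in>B i j. f ((i, j), n))"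
    by (subst sum.cartesian_product) (simp add: case_prod_unfold)
  finally show ?thesis .
qed

lemma t_pos: "t > 0" using t_ge by simp

lemma Q_large: "t ^ 2 \<le> Q"
proof -
  have "t ^ 2 \<le> (2 ^ t) ^ 2" using less_exp[of t] by (intro power_mono) auto
  also have "\<dots> = 2 ^ (t * 2)" by (rule power_mult[symmetric])
  also have "\<dots> \<le> 2 ^ (20 * t)" by (intro power_increasing) auto
  finally show ?thesis using Q_ge by simp
qed

lemma \<psi>_pos: "\<epsilon> > 0 \<Longrightarrow> \<psi> \<epsilon> i j > 0"
  using N_pos[of i] \<delta>_pos[of j] t_pos by (simp add: \<psi>_def)

lemma \<psi>_less:
  assumes "0 < \<epsilon>" "\<epsilon> \<le> 1" "j < t"
  shows "\<psi> \<epsilon> i j < 1 / 2"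
proof -
  have "q \<le> Q" using q_le R_le by simp
  also have "Q \<le> Q\<^sup>2" by (simp add: power2_nat_le_imp_le)
  also have "\<dots> \<le> N i" by (rule Q2_le_N)
  finally have "q \<le> N i" .
  then have "1 \<le> (1 / q) * N i" using q_pos by simp
  also have "\<dots> \<le> \<delta> j * N i" using \<delta>_ge[OF assms(3)] by (intro mult_right_mono) auto
  finally have 1: "1 \<le> N i * \<delta> j" by (simp add: mult.commute)
  have "(24::real) * 24 \<le> real t * real t" using t_ge by (intro mult_mono) auto
  then have "1 * 4 \<le> (N i * \<delta> j) * real t ^ 2" using 1 by (intro mult_mono) (auto simp: power2_eq_square)
  then show ?thesis using assms by (simp add: \<psi>_def field_simps)
qed

text \<open>The case \<open>d = 1\<close> of the count of multiples.\<close>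

lemma card_B_le:
  assumes "j < t"
  shows "card (B i j) \<le> 20 * \<delta> j * N i"
proof -
  have "q \<le> Q" using q_le R_le by simp
  then have "good 1" using good_of_le[of 1] by simp
  moreover have "2 * 1 \<le> Q\<^sup>2"
  proof -
    have "2 ^ 1 \<le> (2::nat) ^ (20 * t)" using t_ge by (intro power_increasing) auto
    then have "2 \<le> Q" using Q_ge by simp
    also have "\<dots> \<le> Q\<^sup>2" using Q_pos by (simp add: power2_eq_square)
    finally show ?thesis by simp
  qed
  ultimately show ?thesis using card_B_multiples_le(2)[of 1 j i] assms by simp
qed

text \<open>Each of the \<open>t\<^sup>2\<close> cells has at least \<open>\<delta> j * N i\<close>
  elements and so contributes at least \<open>\<epsilon> / t\<^sup>2 * (v - u)\<close>. The
  condition on \<open>Q\<close> lets every \<open>n >= Q\<close> resolve the interval.\<close>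

lemma sum_measure_Hit_ge:
  fixes u v :: real
  assumes \<epsilon>: "0 < \<epsilon>" "\<epsilon> \<le> 1" and uv: "4 \<le> Q * (v - u)"
  shows "\<epsilon> * (v - u) \<le> (\<Sum>k\<in>Idx. measure lborel ({u..<v} \<inter> Hit \<epsilon> c k))"
proof -
  have "0 < real Q * (v - u)" using uv by linarith
  then have "0 < v - u" using Q_pos by (simp add: zero_less_mult_iff)
  have "\<epsilon> * (v - u) = (\<Sum>i<t. \<Sum>j<t. \<epsilon> / real t ^ 2 * (v - u))"
    using t_pos by (simp add: power2_eq_square)
  also have "\<dots> \<le> (\<Sum>i<t. \<Sum>j<t. \<Sum>n\<in>B i j. measure lborel ({u..<v} \<inter> Hit \<epsilon> c ((i, j), n)))"
  proof (intro sum_mono)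
    fix i j assume "i \<in> {..<t}" "j \<in> {..<t}"
    then have j: "j < t" by simp
    have "\<epsilon> / real t ^ 2 * (v - u) = (\<delta> j * N i) * (\<psi> \<epsilon> i j * (v - u))"
      using N_pos[of i] \<delta>_pos[of j] t_pos by (simp add: \<psi>_def)
    also have "\<dots> \<le> card (B i j) * (\<psi> \<epsilon> i j * (v - u))"
      using card_B_ge[OF j] \<psi>_pos[OF \<epsilon>(1), of i j] \<open>0 < v - u\<close> by (intro mult_right_mono) auto
    also have "\<dots> = (\<Sum>n\<in>B i j. \<psi> \<epsilon> i j * (v - u))" by simp
    also have "\<dots> \<le> (\<Sum>n\<in>B i j. measure lborel ({u..<v} \<inter> Hit \<epsilon> c ((i, j), n)))"
    proof (rule sum_mono)
      fix n assume n: "n \<in> B i j"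
      have "Q \<le> Q\<^sup>2" by (simp add: power2_nat_le_imp_le)
      also have "\<dots> \<le> n" using n Q2_le_N[of i] by (auto simp: B_def)
      finally have "real Q * (v - u) \<le> real n * (v - u)" using \<open>0 < v - u\<close> by (intro mult_right_mono) auto
      then have "4 \<le> real n * (v - u)" using uv by linarith
      then show "\<psi> \<epsilon> i j * (v - u) \<le> measure lborel ({u..<v} \<inter> Hit \<epsilon> c ((i, j), n))"
        unfolding Hit_def fst_conv snd_conv
        using \<psi>_pos[OF \<epsilon>(1), of i j] \<psi>_less[OF \<epsilon> j, of i] by (intro measure_near_ge) auto
    qed
    finally show "\<epsilon> / real t ^ 2 * (v - u) \<le> (\<Sum>n\<in>B i j. measure lborel ({u..<v} \<inter> Hit \<epsilon> c ((i, j), n)))" .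
  qed
  finally show ?thesis by (simp only: sum_Idx)
qed

text \<open>The product terms add up to a multiple of \<open>T\<^sup>2\<close>, where
  \<open>T <= 20\<close> is the sum of all radii; in the gcd terms the factor
  \<open>1 / t\<^sup>2\<close> cancels the growth in \<open>sum_mu_gcd_le\<close>. The bound is
  uniform in the block and in \<open>\<epsilon>\<close>.\<close>

lemma sum_measure_Hit_Int_le:
  assumes \<epsilon>: "0 < \<epsilon>" "\<epsilon> \<le> 1"
  shows "(\<Sum>k\<in>Idx. \<Sum>l\<in>Idx. measure lborel ({0..<1} \<inter> Hit \<epsilon> c k \<inter> Hit \<epsilon> c l)) \<le> 10000000"
proof -
  have pair: "measure lborel ({0..<1} \<inter> Hit \<epsilon> c ((i, j), n) \<inter> Hit \<epsilon> c ((i', j'), m))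
      \<le> 32 * (\<psi> \<epsilon> i j * \<psi> \<epsilon> i' j') + 8 / real t ^ 2 * (\<mu> i j i' j' * gcd n m)"
    if ij: "j < t" "j' < t" and n: "n \<in> B i j" and m: "m \<in> B i' j'" for i j i' j' n m
  proof -
    have n0: "0 < n" "N i \<le> n" and m0: "0 < m" "N i' \<le> m"
      using n m N_pos[of i] N_pos[of i'] by (auto simp: B_def)
    have frac: "\<psi> \<epsilon> i j / n \<le> 1 / real t ^ 2 * (1 / (real (N i) ^ 2 * \<delta> j))" if "N i \<le> n" for i j n
    proof -
      have "\<psi> \<epsilon> i j / n \<le> (1 / (real (N i) * \<delta> j * real t ^ 2)) / N i"
        unfolding \<psi>_def using that \<epsilon> N_pos[of i] \<delta>_pos[of j] t_pos by (intro frac_le divide_right_mono) auto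
      then show ?thesis by (simp add: power2_eq_square mult_ac)
    qed
    have "min (\<psi> \<epsilon> i j / n) (\<psi> \<epsilon> i' j' / m) \<le> 1 / real t ^ 2 * \<mu> i j i' j'"
    proof -
      have "1 / real t ^ 2 * \<mu> i j i' j' = min (1 / real t ^ 2 * (1 / (real (N i) ^ 2 * \<delta> j))) (1 / real t ^ 2 * (1 / (real (N i') ^ 2 * \<delta> j')))"
        unfolding \<mu>_def by (simp add: min_mult_distrib_left)
      then show ?thesis using frac[OF n0(2), of j] frac[OF m0(2), of j'] by linarith
    qed
    then have "8 * real (gcd n m) * min (\<psi> \<epsilon> i j / n) (\<psi> \<epsilon> i' j' / m) \<le> 8 * real (gcd n m) * (1 / real t ^ 2 * \<mu> i j i' j')"
      by (intro mult_left_mono) auto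
    moreover have "measure lborel ({0..<1} \<inter> {x. near (\<psi> \<epsilon> i j) (real n * x + c) \<and> near (\<psi> \<epsilon> i' j') (real m * x + c)})
        \<le> 32 * \<psi> \<epsilon> i j * \<psi> \<epsilon> i' j' + 8 * gcd n m * min (\<psi> \<epsilon> i j / n) (\<psi> \<epsilon> i' j' / m)"
      using n0 m0 \<psi>_pos[OF \<epsilon>(1), of i j] \<psi>_pos[OF \<epsilon>(1), of i' j'] \<psi>_less[OF \<epsilon> ij(1), of i] \<psi>_less[OF \<epsilon> ij(2), of i']
      by (intro measure_near_Int_near_le) auto
    moreover have "{0..<1} \<inter> Hit \<epsilon> c ((i, j), n) \<inter> Hit \<epsilon> c ((i', j'), m)
        = {0..<1} \<inter> {x. near (\<psi> \<epsilon> i j) (real n * x + c) \<and> near (\<psi> \<epsilon> i' j') (real m * x + c)}"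
      by (auto simp: Hit_def)
    ultimately show ?thesis by (simp add: mult_ac)
  qed
  define T where "T = (\<Sum>i<t. \<Sum>j<t. \<Sum>n\<in>B i j. \<psi> \<epsilon> i j)"
  have T: "0 \<le> T" "T \<le> 20"
  proof -
    show "0 \<le> T" unfolding T_def using \<psi>_pos[OF \<epsilon>(1)] by (intro sum_nonneg) (simp add: less_imp_le)
    have "T \<le> (\<Sum>i<t. \<Sum>j<t. 20 / real t ^ 2)"
      unfolding T_def
    proof (intro sum_mono)
      fix i j assume "i \<in> {..<t}" "j \<in> {..<t}"
      then have "(\<Sum>n\<in>B i j. \<psi> \<epsilon> i j) \<le> (20 * \<delta> j * N i) * \<psi> \<epsilon> i j"
        using card_B_le[of j i] \<psi>_pos[OF \<epsilon>(1), of i j] by (simp add: mult_right_mono)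
      also have "\<dots> = 20 * \<epsilon> / real t ^ 2" using N_pos[of i] \<delta>_pos[of j] by (simp add: \<psi>_def)
      also have "\<dots> \<le> 20 / real t ^ 2" using \<epsilon> by (intro divide_right_mono) auto
      finally show "(\<Sum>n\<in>B i j. \<psi> \<epsilon> i j) \<le> 20 / real t ^ 2" .
    qed
    also have "\<dots> = 20" using t_pos by (simp add: power2_eq_square)
    finally show "T \<le> 20" .
  qed
  have "(\<Sum>k\<in>Idx. \<Sum>l\<in>Idx. measure lborel ({0..<1} \<inter> Hit \<epsilon> c k \<inter> Hit \<epsilon> c l))
      \<le> (\<Sum>i<t. \<Sum>j<t. \<Sum>n\<in>B i j. \<Sum>i'<t. \<Sum>j'<t. \<Sum>m\<in>B i' j'.
           32 * (\<psi> \<epsilon> i j * \<psi> \<epsilon> i' j') + 8 / real t ^ 2 * (\<mu> i j i' j' * gcd n m))"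
    unfolding sum_Idx by (intro sum_mono pair) auto
  also have "\<dots> = 32 * (T * T) + 8 / real t ^ 2 *
      (\<Sum>i<t. \<Sum>j<t. \<Sum>n\<in>B i j. \<Sum>i'<t. \<Sum>j'<t. \<Sum>m\<in>B i' j'. \<mu> i j i' j' * gcd n m)"
  proof -
    have "T * T = (\<Sum>i<t. \<Sum>j<t. \<Sum>n\<in>B i j. \<Sum>i'<t. \<Sum>j'<t. \<Sum>m\<in>B i' j'. \<psi> \<epsilon> i j * \<psi> \<epsilon> i' j')"
    proof -
      have "T * T = (\<Sum>i<t. \<Sum>j<t. \<Sum>n\<in>B i j. \<psi> \<epsilon> i j * T)" unfolding T_def by (simp only: sum_distrib_right)
      also have "\<dots> = (\<Sum>i<t. \<Sum>j<t. \<Sum>n\<in>B i j. \<Sum>i'<t. \<Sum>j'<t. \<Sum>m\<in>B i' j'. \<psi> \<epsilon> i j * \<psi> \<epsilon> i' j')"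
        unfolding T_def by (simp only: sum_distrib_left)
      finally show ?thesis .
    qed
    then show ?thesis by (simp only: sum.distrib sum_distrib_left)
  qed
  also have "(\<Sum>i<t. \<Sum>j<t. \<Sum>n\<in>B i j. \<Sum>i'<t. \<Sum>j'<t. \<Sum>m\<in>B i' j'. \<mu> i j i' j' * gcd n m)
      = (\<Sum>i<t. \<Sum>j<t. \<Sum>i'<t. \<Sum>j'<t. \<mu> i j i' j' * (\<Sum>n\<in>B i j. \<Sum>m\<in>B i' j'. real (gcd n m)))"
  proof (intro sum.cong[OF refl])
    fix i j
    have "(\<Sum>n\<in>B i j. \<Sum>i'<t. \<Sum>j'<t. \<Sum>m\<in>B i' j'. \<mu> i j i' j' * gcd n m)
        = (\<Sum>i'<t. \<Sum>n\<in>B i j. \<Sum>j'<t. \<Sum>m\<in>B i' j'. \<mu> i j i' j' * gcd n m)"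
      by (rule sum.swap)
    also have "\<dots> = (\<Sum>i'<t. \<Sum>j'<t. \<Sum>n\<in>B i j. \<Sum>m\<in>B i' j'. \<mu> i j i' j' * gcd n m)"
      by (intro sum.cong[OF refl] sum.swap)
    also have "\<dots> = (\<Sum>i'<t. \<Sum>j'<t. \<mu> i j i' j' * (\<Sum>n\<in>B i j. \<Sum>m\<in>B i' j'. real (gcd n m)))"
      by (simp only: sum_distrib_left)
    finally show "(\<Sum>n\<in>B i j. \<Sum>i'<t. \<Sum>j'<t. \<Sum>m\<in>B i' j'. \<mu> i j i' j' * gcd n m) = \<dots>" .
  qed
  also have "32 * (T * T) + 8 / real t ^ 2 * \<dots> \<le> 32 * (20 * 20) + 8 / real t ^ 2 * (1000000 * real t ^ 2)"
    using T by (intro add_mono mult_left_mono mult_mono sum_mu_gcd_le) auto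
  also have "\<dots> \<le> 10000000" using t_pos by simp
  finally show ?thesis .
qed

text \<open>The denominator \<open>N i * \<delta> j * t\<^sup>2\<close> of the radius cancels
  against \<open>n\<close>, the first distance and the squared logarithm. From
  \<open>n < 2 * N i\<close> and \<open>ln n <= 43 * t\<close> the constant is
  \<open>2 * 43\<^sup>2 = 3698\<close>.\<close>

lemma Hit_imp_small_product:
  assumes \<epsilon>: "0 < \<epsilon>" "\<epsilon> \<le> 1" and k: "k \<in> Idx" "x \<in> Hit \<epsilon> (- \<gamma>') k"
  shows "\<exists>n\<ge>t. real n * (ln (real n))\<^sup>2 * dist_nearest_int (real n * \<alpha> - \<gamma>) * dist_nearest_int (real n * x - \<gamma>') \<le> 4000 * \<epsilon>"
proof -
  obtain i j n where k_eq: "k = ((i, j), n)" by (metis prod.exhaust)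
  have i: "i < t" and n: "n \<in> B i j" using k by (auto simp: k_eq Idx_def)
  have range: "N i \<le> n" "n < 2 * N i" using n by (auto simp: B_def)
  have d1: "dist_nearest_int (real n * \<alpha> - \<gamma>) \<le> \<delta> j" using n by (simp add: B_def near_iff_dist)
  have d2: "dist_nearest_int (real n * x - \<gamma>') \<le> \<psi> \<epsilon> i j"
    using k by (simp add: Hit_def k_eq near_iff_dist)
  have dnn: "0 \<le> dist_nearest_int y" for y by (simp add: dist_nearest_int_def)
  have n0: "n > 0" using range N_pos[of i] by simp
  have "ln (real n) \<le> 43 * real t"
  proof -
    have "N i \<le> Q\<^sup>2 * 2 ^ t" using i by (simp add: N_def)
    then have "n \<le> 2 * (Q\<^sup>2 * 2 ^ t)" using range by simp
    then have "real n \<le> real (2 * (Q\<^sup>2 * 2 ^ t))" by (rule of_nat_mono)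
    then have "ln (real n) \<le> ln (2 * (real Q ^ 2 * 2 ^ t))" using n0 by (intro ln_mono) auto
    also have "\<dots> = ln 2 + (2 * ln (real Q) + real t * ln 2)"
      using Q_pos by (simp add: ln_mult ln_realpow)
    also have "\<dots> \<le> 1 + (40 * (real t + 1) + real t * 1)"
      using ln_Q_le ln_le_minus_one[of 2] by (intro add_mono mult_left_mono) auto
    also have "\<dots> \<le> 43 * real t" using t_ge by simp
    finally show ?thesis .
  qed
  then have ln2: "(ln (real n))\<^sup>2 \<le> (43 * real t)\<^sup>2" using n0 by (intro power_mono) auto
  have "real n * (ln (real n))\<^sup>2 \<le> (2 * real (N i)) * (43 * real t)\<^sup>2"
    using range ln2 by (intro mult_mono) auto
  from mult_mono[OF this d1] have "real n * (ln (real n))\<^sup>2 * dist_nearest_int (real n * \<alpha> - \<gamma>) \<le> (2 * real (N i)) * (43 * real t)\<^sup>2 * \<delta> j"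
    by (simp add: dnn)
  from mult_mono[OF this d2] have "real n * (ln (real n))\<^sup>2 * dist_nearest_int (real n * \<alpha> - \<gamma>) * dist_nearest_int (real n * x - \<gamma>')
     \<le> (2 * real (N i)) * (43 * real t)\<^sup>2 * \<delta> j * \<psi> \<epsilon> i j"
    using \<delta>_pos[of j] by (simp add: dnn)
  also have "\<dots> = 3698 * \<epsilon>" using N_pos[of i] \<delta>_pos[of j] t_pos by (simp add: \<psi>_def power_mult_distrib)
  also have "\<dots> \<le> 4000 * \<epsilon>" using \<epsilon> by simp
  finally have le: "real n * (ln (real n))\<^sup>2 * dist_nearest_int (real n * \<alpha> - \<gamma>) * dist_nearest_int (real n * x - \<gamma>') \<le> 4000 * \<epsilon>" .
  have "t \<le> t\<^sup>2" by (simp add: power2_nat_le_imp_le)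
  also have "\<dots> \<le> Q" by (rule Q_large)
  also have "Q \<le> Q\<^sup>2" by (simp add: power2_nat_le_imp_le)
  also have "\<dots> \<le> n" using range Q2_le_N[of i] by simp
  finally show ?thesis using le by blast
qed

end

section \<open>From single blocks to almost every point\<close>

text \<open>Irrationality yields approximations \<open>h / k\<close> with error below
  \<open>1 / k\<^sup>2\<close> and arbitrarily large \<open>k\<close>. Taking \<open>k\<close>
  beyond the threshold for \<open>m + 24\<close> secures both \<open>m <= t\<close> and
  \<open>24 <= t\<close>.\<close>

lemma ex_approx_block:
  assumes "\<alpha> \<notin> \<rat>"
  shows "\<exists>p Q t. m \<le> t \<and> approx_block \<alpha> p Q t"
proof -
  have "infinite (approx_set \<alpha>)" using assms rational_iff_finite_approx_set by blast
  then obtain h k where hk: "(h, k) \<in> approx_set \<alpha>" "k > 2 ^ (20 * (m + 24))"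
    using infinite_approx_set by blast
  then have k: "k > 0" "coprime h k" "\<bar>\<alpha> - of_int h / of_int k\<bar> < 1 / (of_int k)\<^sup>2"
    by (auto simp: approx_set_def)
  define Q where "Q = nat k"
  have kQ: "k = int Q" and Q0: "Q > 0" using k(1) by (simp_all add: Q_def)
  have "int (2 ^ (20 * (m + 24))) < int Q" using hk(2) by (simp add: kQ)
  then have Ql: "2 ^ (20 * (m + 24)) \<le> Q" by linarith
  define t where "t = Max {s. 2 ^ (20 * s) \<le> Q}"
  have fin: "finite {s. 2 ^ (20 * s) \<le> Q}"
  proof (rule finite_subset)
    have "s \<le> Q" if "2 ^ (20 * s) \<le> Q" for s
    proof -
      have "s \<le> 20 * s" by simp
      also have "\<dots> < 2 ^ (20 * s)" by (rule less_exp)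
      finally show ?thesis using that by simp
    qed
    then show "{s. 2 ^ (20 * s) \<le> Q} \<subseteq> {..Q}" by auto
  qed simp
  have mt: "m + 24 \<le> t" unfolding t_def using fin Ql by (intro Max_ge) auto
  have "m + 24 \<in> {s. 2 ^ (20 * s) \<le> Q}" using Ql by simp
  then have "t \<in> {s. 2 ^ (20 * s) \<le> Q}" unfolding t_def using fin by (intro Max_in) blast+
  moreover have "Q < 2 ^ (20 * (t + 1))"
  proof (rule ccontr)
    assume "\<not> Q < 2 ^ (20 * (t + 1))"
    then have "t + 1 \<le> t" unfolding t_def using fin by (intro Max_ge) auto
    then show False by simp
  qed
  moreover have "real Q * \<bar>\<alpha> - of_int h / real Q\<bar> \<le> 1 / real Q"
    using k(3) Q0 by (simp add: kQ field_simps power2_eq_square)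
  ultimately have "approx_block \<alpha> h Q t" using k(2) mt by unfold_locales (auto simp: kQ)
  then show ?thesis using mt by (intro exI[of _ h] exI[of _ Q] exI[of _ t]) auto
qed

lemma dist_nearest_int_add_int: "dist_nearest_int (x + of_int k) = dist_nearest_int x"
  by (metis near_iff_dist near_add_int order_refl antisym)

text \<open>One block with \<open>t m >= m\<close> is chosen for every \<open>m\<close>, and the
  moment bounds feed the criterion. Outside its null set infinitely many blocks are hit, and a hit
  in block \<open>m\<close> supplies some \<open>n >= t m\<close>.\<close>

lemma null_sets_not_frequently_small:
  fixes \<alpha> \<gamma> \<gamma>' :: real
  assumes \<alpha>: "\<alpha> \<notin> \<rat>" and \<epsilon>: "0 < \<epsilon>" "\<epsilon> \<le> 1"
  shows "\<exists>Z \<in> null_sets lborel. \<forall>x\<in>{0..<1} - Z. \<exists>\<^sub>F n in sequentially.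
    real n * (ln (real n))\<^sup>2 * dist_nearest_int (real n * \<alpha> - \<gamma>) * dist_nearest_int (real n * x - \<gamma>') \<le> 4000 * \<epsilon>"
proof -
  obtain p Q t where blk: "\<And>m. m \<le> t m" "\<And>m. approx_block \<alpha> (p m) (Q m) (t m)"
    using ex_approx_block[OF \<alpha>] by metis
  let ?I = "\<lambda>m. approx_block.Idx \<alpha> \<gamma> (Q m) (t m)"
  let ?A = "\<lambda>m. approx_block.Hit (Q m) (t m) \<epsilon> (- \<gamma>')"
  let ?Z = "{x \<in> {0..<1}. eventually (\<lambda>m. \<forall>k\<in>?I m. x \<notin> ?A m k) sequentially}"
  have "?Z \<in> null_sets lborel"
  proof (rule null_sets_of_quasi_independent[where c = \<epsilon> and C = 10000000])
    fix u v :: real assume uv: "u < v"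
    have "eventually (\<lambda>m. 4 / (v - u) \<le> real m) sequentially"
      using eventually_ge_at_top[of "nat \<lceil>4 / (v - u)\<rceil>"] by eventually_elim linarith
    then show "eventually (\<lambda>m. \<epsilon> * (v - u) \<le> (\<Sum>k\<in>?I m. measure lborel ({u..<v} \<inter> ?A m k))) sequentially"
    proof eventually_elim
      case (elim m)
      interpret approx_block \<alpha> \<gamma> "p m" "Q m" "t m" by (rule blk)
      have "m \<le> t m" by (rule blk(1))
      also have "\<dots> \<le> (t m)\<^sup>2" by (simp add: power2_nat_le_imp_le)
      finally have "m \<le> (t m)\<^sup>2" .
      then have "real m \<le> Q m" using Q_large by simp
      then have "4 / (v - u) \<le> Q m" using elim by simp
      then have "4 \<le> Q m * (v - u)" using uv by (simp add: field_simps)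
      then show ?case by (intro sum_measure_Hit_ge \<epsilon>)
    qed
  qed (use approx_block.finite_Idx[OF blk(2)] approx_block.Hit_borel[OF blk(2)]
      approx_block.sum_measure_Hit_Int_le[OF blk(2) \<epsilon>] \<epsilon> in auto)
  moreover have "\<exists>\<^sub>F n in sequentially. real n * (ln (real n))\<^sup>2 * dist_nearest_int (real n * \<alpha> - \<gamma>) * dist_nearest_int (real n * x - \<gamma>') \<le> 4000 * \<epsilon>"
    if "x \<in> {0..<1} - ?Z" for x
    unfolding frequently_sequentially
  proof
    fix n0
    have "\<not> eventually (\<lambda>m. \<forall>k\<in>?I m. x \<notin> ?A m k) sequentially" using that by simp
    then obtain m k where m: "n0 \<le> m" "k \<in> ?I m" "x \<in> ?A m k"
      unfolding eventually_sequentially by blast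
    obtain n where "n \<ge> t m" "real n * (ln (real n))\<^sup>2 * dist_nearest_int (real n * \<alpha> - \<gamma>) * dist_nearest_int (real n * x - \<gamma>') \<le> 4000 * \<epsilon>"
      using approx_block.Hit_imp_small_product[OF blk(2) \<epsilon> m(2,3)] by blast
    then show "\<exists>n\<ge>n0. real n * (ln (real n))\<^sup>2 * dist_nearest_int (real n * \<alpha> - \<gamma>) * dist_nearest_int (real n * x - \<gamma>') \<le> 4000 * \<epsilon>"
      using m(1) blk(1)[of m] by (meson le_trans)
  qed
  ultimately show ?thesis by blast
qed

theorem theorem1p13:
  fixes \<alpha>1 \<gamma>1 \<gamma>2 :: real
  assumes "\<alpha>1 \<notin> \<rat>"
  shows "AE \<alpha>2 in (lebesgue :: real measure).
    liminf (\<lambda>n::nat. ereal (real n * (ln (real n))\<^sup>2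
      * dist_nearest_int (real n * \<alpha>1 - \<gamma>1)
      * dist_nearest_int (real n * \<alpha>2 - \<gamma>2))) = 0"
proof -
  define f where "f x n = real n * (ln (real n))\<^sup>2 * dist_nearest_int (real n * \<alpha>1 - \<gamma>1) * dist_nearest_int (real n * x - \<gamma>2)" for x and n :: nat
  \<comment> \<open>Taking \<open>\<epsilon> = 1 / (k + 1)\<close> reduces arbitrarily small bounds
    to countably many null sets.\<close>
  have "\<forall>k::nat. \<exists>Z \<in> null_sets lborel. \<forall>x\<in>{0..<1} - Z. \<exists>\<^sub>F n in sequentially. f x n \<le> 4000 * (1 / (real k + 1))"
  proof
    fix k :: nat
    show "\<exists>Z \<in> null_sets lborel. \<forall>x\<in>{0..<1} - Z. \<exists>\<^sub>F n in sequentially. f x n \<le> 4000 * (1 / (real k + 1))"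
      unfolding f_def by (rule null_sets_not_frequently_small[OF assms]) simp_all
  qed
  then obtain Z where Z: "\<And>k. Z k \<in> null_sets lborel"
    "\<And>k x. x \<in> {0..<1} - Z k \<Longrightarrow> \<exists>\<^sub>F n in sequentially. f x n \<le> 4000 * (1 / (real k + 1))"
    by metis
  \<comment> \<open>The sets \<open>Z k\<close> serve only points of the unit interval; as
    \<open>f x n\<close> depends on \<open>x\<close> modulo one, their integer translates serve the
    whole line.\<close>
  define Y where "Y = (\<Union>l::int. {x. x - of_int l \<in> (\<Union>k. Z k)})"
  have "Y \<in> null_sets lborel"
    unfolding Y_def using Z(1) by (intro null_sets_UN' null_sets_translation) auto
  moreover have "liminf (\<lambda>n. ereal (f x n)) = 0" if "x \<notin> Y" for x
  proof (rule antisym)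
    define y where "y = x - of_int \<lfloor>x\<rfloor>"
    have y: "y \<in> {0..<1}" by (simp add: y_def) linarith
    have yZ: "y \<notin> Z k" for k using that by (auto simp: Y_def y_def)
    have feq: "f x n = f y n" for n
    proof -
      have "real n * x - \<gamma>2 = (real n * y - \<gamma>2) + of_int (int n * \<lfloor>x\<rfloor>)" by (simp add: y_def algebra_simps)
      then show ?thesis unfolding f_def by (simp only: dist_nearest_int_add_int)
    qed
    show "liminf (\<lambda>n. ereal (f x n)) \<le> 0"
    proof (rule ccontr)
      assume "\<not> liminf (\<lambda>n. ereal (f x n)) \<le> 0"
      then obtain r :: real where r: "0 < r" "ereal r < liminf (\<lambda>n. ereal (f x n))"
        using ereal_dense2[of 0 "liminf (\<lambda>n. ereal (f x n))"] by (auto simp: zero_ereal_def not_le)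
      obtain k :: nat where k: "4000 / r < real k" using reals_Archimedean2 by blast
      then have "4000 * (1 / (real k + 1)) \<le> r" using r(1) by (simp add: field_simps)
      moreover have "\<exists>\<^sub>F n in sequentially. f x n \<le> 4000 * (1 / (real k + 1))"
        unfolding feq using y yZ by (intro Z(2)) simp
      ultimately have "\<exists>\<^sub>F n in sequentially. f x n \<le> r"
        by (elim frequently_elim1) (rule order_trans)
      moreover have "eventually (\<lambda>n. r < f x n) sequentially" using less_LiminfD[OF r(2)] by simp
      ultimately show False by (simp add: frequently_def not_le)
    qed
    show "0 \<le> liminf (\<lambda>n. ereal (f x n))"
      by (intro Liminf_bounded always_eventually allI) (simp add: f_def dist_nearest_int_def)
  qed
  ultimately have "AE x in lborel. liminf (\<lambda>n. ereal (f x n)) = 0"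
    by (auto intro: AE_I'[of Y])
  then show ?thesis unfolding f_def by (rule AE_completion)
qed

end
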